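(* Let $F$ be a field of characteristic $2$, let $\phi,\psi$ be (arbitrary, possibly singular) quadratic forms over $F$ with $\dim\phi=\dim\psi$, and let $L/F$ be a field extension of odd degree. Then $\phi$ and $\psi$ are similar over $F$ if and only if $\phi_L$ and $\psi_L$ are similar over $L$. More precisely, suppose $\lambda\in L^*$ satisfies $\phi_L\cong\lambda\psi_L$, and let $a_n$ be the constant term of the minimal polynomial $X^n+a_1X^{n-1}+\dots+a_n$ of $\lambda$ over $F$, where $n=[F(\lambda):F]$. Then $\phi\cong a_n\psi$ over $F$.
   Context: Two quadratic forms $\phi,\psi$ over a field $E$ are similar if $\phi\cong c\psi$ for some $c\in E^*$. *)

theory Defs
  imports "HOL-Analysis.Analysis" "HOL-Computational_Algebra.Polynomial"
begin

text \<open>The base field F is modelled as a subfield K of the field L (the type 'a).\<close>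

definition is_subfield :: "'a::field set \<Rightarrow> bool" where
  "is_subfield K \<longleftrightarrow> 0 \<in> K \<and> 1 \<in> K \<and>
     (\<forall>x\<in>K. \<forall>y\<in>K. x + y \<in> K \<and> x - y \<in> K \<and> x * y \<in> K) \<and>
     (\<forall>x\<in>K. x \<noteq> 0 \<longrightarrow> inverse x \<in> K)"

definition basis_over :: "'a::field set \<Rightarrow> 'a list \<Rightarrow> bool" where
  "basis_over K bs \<longleftrightarrow>
     (\<forall>c. (\<forall>i<length bs. c i \<in> K) \<and> (\<Sum>i<length bs. c i * bs ! i) = 0
            \<longrightarrow> (\<forall>i<length bs. c i = 0)) \<and>
     (\<forall>y. \<exists>c. (\<forall>i<length bs. c i \<in> K) \<and> y = (\<Sum>i<length bs. c i * bs ! i))"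

definition odd_degree_over :: "'a::field set \<Rightarrow> bool" where
  "odd_degree_over K \<longleftrightarrow> (\<exists>bs. basis_over K bs \<and> odd (length bs))"

text \<open>Quadratic form in the variables indexed by 'n with coefficient matrix A:
  q_A(x) = sum_{i,j} A_ij x_i x_j (every quadratic form, singular or not, has this shape).\<close>
definition qf :: "'a::comm_ring_1 ^'n^'n \<Rightarrow> 'a ^'n \<Rightarrow> 'a" where
  "qf A x = (\<Sum>i\<in>UNIV. \<Sum>j\<in>UNIV. A $ i $ j * x $ i * x $ j)"

definition qscale :: "'a::comm_ring_1 \<Rightarrow> 'a ^'n^'n \<Rightarrow> 'a ^'n^'n" where
  "qscale c A = (\<chi> i j. c * A $ i $ j)"

definition vec_in :: "'a set \<Rightarrow> 'a ^'n \<Rightarrow> bool" where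
  "vec_in S x \<longleftrightarrow> (\<forall>i. x $ i \<in> S)"

definition mat_in :: "'a set \<Rightarrow> 'a ^'n^'m \<Rightarrow> bool" where
  "mat_in S M \<longleftrightarrow> (\<forall>i j. M $ i $ j \<in> S)"

definition isometric_over :: "'a::field set \<Rightarrow> 'a ^'n^'n \<Rightarrow> 'a ^'n^'n \<Rightarrow> bool" where
  "isometric_over S A B \<longleftrightarrow>
     (\<exists>T T'. mat_in S T \<and> mat_in S T' \<and> T ** T' = mat 1 \<and> T' ** T = mat 1 \<and>
        (\<forall>x. vec_in S x \<longrightarrow> qf B (T *v x) = qf A x))"

definition similar_over :: "'a::field set \<Rightarrow> 'a ^'n^'n \<Rightarrow> 'a ^'n^'n \<Rightarrow> bool" where
  "similar_over S A B \<longleftrightarrow> (\<exists>c\<in>S. c \<noteq> 0 \<and> isometric_over S A (qscale c B))"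

definition is_min_poly :: "'a::field set \<Rightarrow> 'a \<Rightarrow> 'a poly \<Rightarrow> bool" where
  "is_min_poly K a p \<longleftrightarrow> lead_coeff p = 1 \<and> (\<forall>i. coeff p i \<in> K) \<and> poly p a = 0 \<and>
     (\<forall>q. q \<noteq> 0 \<and> (\<forall>i. coeff q i \<in> K) \<and> poly q a = 0 \<longrightarrow> degree p \<le> degree q)"

end

theory Submission
  imports Defs
begin

text \<open>
  Springer's descent shows that an anisotropic form stays anisotropic over an odd-degree extension.
  Combined with Witt decomposition and Witt cancellation, valid for singular forms as well once null
  vectors of the radical are cancelled separately, this reduces the theorem to anisotropic forms.
  For these, let \<open>f\<close> be a similitude over \<open>K(l)\<close> with factor \<open>l\<close>, where \<open>[K(l):K] = 2m+1\<close>.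
  Polynomial vectors \<open>x, y\<close> of degree at most \<open>m\<close> with \<open>f(x(l)) = y(l)\<close> satisfy
  \<open>q(x) - X q'(y) = c p\<close> for the minimal polynomial \<open>p\<close> of \<open>l\<close>, and comparing extreme coefficients
  gives \<open>q(x(0)) = - p(0) q'(top coefficient of y)\<close>. A dimension count and anisotropy make
  \<open>x(0)\<close> determine the top coefficient of \<open>y\<close>, which is the required similitude over \<open>K\<close>.
  To pass from \<open>L\<close> down to \<open>K(l)\<close>, an isometry is turned into a similitude with factor \<open>a\<^sup>2\<close>, where
  \<open>a \<in> K(a\<^sup>2)\<close> because degrees are odd.
\<close>

section \<open>Linear algebra and quadratic forms over a subfield\<close>

text \<open>The bound \<open>m\<close> is forced from two sides. With
  \<open>degree p = 2 * m + 1\<close>, both q(x) and X q'(y) stay within the degree of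
  \<open>p\<close>, so a difference vanishing at \<open>l\<close> is a constant times
  \<open>p\<close>; yet polynomials of degree \<open>m\<close> still have enough coefficients to
  realise every prescribed x(0). Parity does the rest: an anisotropic form takes values of even
  degree on polynomial vectors, so q(x) = X q'(y) has only the zero solution.

  The obstacle is that the similitude is given over L and not over K(l). Bringing it down to K(l)
  means descending an isometry, and its factor 1 generates no extension. Replacing 1 by
  \<open>a ^ 2\<close> supplies a generator; the constant this introduces also appears when q' is
  compared with itself, so it cancels.

  The reduction has to strip the same kind of summand from both forms over K. Hence both anisotropy
  and the existence of an isotropic vector outside the radical are shown to be insensitive to
  odd-degree extensions.\<close>

lemma subfield_closed:
  assumes "is_subfield K"
  shows "0 \<in> K" "1 \<in> K"
    "\<And>x y. x \<in> K \<Longrightarrow> y \<in> K \<Longrightarrow> x + y \<in> K"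
    "\<And>x y. x \<in> K \<Longrightarrow> y \<in> K \<Longrightarrow> x - y \<in> K"
    "\<And>x y. x \<in> K \<Longrightarrow> y \<in> K \<Longrightarrow> x * y \<in> K"
    "\<And>x. x \<in> K \<Longrightarrow> - x \<in> K"
    "\<And>x. x \<in> K \<Longrightarrow> inverse x \<in> K"
    "\<And>x y. x \<in> K \<Longrightarrow> y \<in> K \<Longrightarrow> x / y \<in> K"
    "\<And>x n. x \<in> K \<Longrightarrow> x ^ n \<in> K"
proof -
  show z: "0 \<in> K" and o: "1 \<in> K"
    using assms unfolding is_subfield_def by auto
  show "x + y \<in> K" and d: "x - y \<in> K" and m: "x * y \<in> K" if "x \<in> K" "y \<in> K" for x y
    using assms that unfolding is_subfield_def by auto
  show "- x \<in> K" if "x \<in> K" for x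
    using d[OF z that] by simp
  show i: "inverse x \<in> K" if "x \<in> K" for x
    using assms that z unfolding is_subfield_def by (cases "x = 0") auto
  show "x / y \<in> K" if "x \<in> K" "y \<in> K" for x y
    using m[OF that(1) i[OF that(2)]] by (simp add: field_simps)
  show "x ^ n \<in> K" if "x \<in> K" for x n
    by (induction n) (auto intro: o m that)
qed

lemma subfield_sum:
  assumes "is_subfield K" "\<And>i. i \<in> I \<Longrightarrow> f i \<in> K"
  shows "sum f I \<in> K"
  using assms(2) by (induction I rule: infinite_finite_induct) (auto intro: subfield_closed[OF assms(1)])

lemma is_subfield_UNIV: "is_subfield UNIV"
  by (simp add: is_subfield_def)

text \<open>Gaussian elimination, one equation at a time: a nonzero coefficient at \<open>k\<close>
  eliminates that unknown, and \<open>d\<close> is the system left on the others. All operations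
  stay in \<open>K\<close>, so this single lemma carries every dimension count below.\<close>

lemma homogeneous_system_solution:
  fixes c :: "'i \<Rightarrow> 'j \<Rightarrow> 'a::field"
  assumes K: "is_subfield K" and "finite I" "finite J" "card I < card J"
    and "\<And>i j. i \<in> I \<Longrightarrow> j \<in> J \<Longrightarrow> c i j \<in> K"
  shows "\<exists>x. (\<forall>j\<in>J. x j \<in> K) \<and> (\<exists>j\<in>J. x j \<noteq> 0) \<and> (\<forall>i\<in>I. (\<Sum>j\<in>J. c i j * x j) = 0)"
  using assms(2-)
proof (induction I arbitrary: J c rule: finite_induct)
  case empty
  then have "J \<noteq> {}" by auto
  then show ?case
    by (intro exI[of _ "\<lambda>_. 1"]) (auto intro: subfield_closed[OF K])
next
  case (insert a I)
  show ?case
  proof (cases "\<forall>j\<in>J. c a j = 0")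
    case True
    have "card I < card J" using insert by simp
    then obtain x where "\<forall>j\<in>J. x j \<in> K" "\<exists>j\<in>J. x j \<noteq> 0" "\<forall>i\<in>I. (\<Sum>j\<in>J. c i j * x j) = 0"
      using insert.IH[of J c] insert.prems by auto
    then show ?thesis using True by (intro exI[of _ x]) auto
  next
    case False
    then obtain k where k: "k \<in> J" "c a k \<noteq> 0" by auto
    define J' where "J' = J - {k}"
    define d where "d i j = c i j - c i k * c a j / c a k" for i j
    have fJ': "finite J'" using insert.prems by (simp add: J'_def)
    have "card I < card J'"
      using insert k by (simp add: J'_def card_Diff_singleton)
    moreover have "d i j \<in> K" if "i \<in> I" "j \<in> J'" for i j
      using that insert.prems k unfolding d_def J'_def
      by (auto intro!: subfield_closed[OF K])
    ultimately obtain x where x: "\<forall>j\<in>J'. x j \<in> K" "\<exists>j\<in>J'. x j \<noteq> 0"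
        "\<forall>i\<in>I. (\<Sum>j\<in>J'. d i j * x j) = 0"
      using insert.IH[of J' d] fJ' by auto
    define t where "t = - (\<Sum>j\<in>J'. c a j * x j) / c a k"
    define y where "y = x(k := t)"
    have tK: "t \<in> K" unfolding t_def
      using x insert.prems k
      by (auto intro!: subfield_closed[OF K] subfield_sum[OF K] simp: J'_def)
    have split: "(\<Sum>j\<in>J. c i j * y j) = c i k * t + (\<Sum>j\<in>J'. c i j * x j)" for i
    proof -
      have "(\<Sum>j\<in>J. c i j * y j) = c i k * y k + (\<Sum>j\<in>J'. c i j * y j)"
        using insert.prems k by (simp add: J'_def sum.remove)
      also have "(\<Sum>j\<in>J'. c i j * y j) = (\<Sum>j\<in>J'. c i j * x j)"
        by (rule sum.cong) (auto simp: y_def J'_def)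
      finally show ?thesis by (simp add: y_def)
    qed
    have "(\<Sum>j\<in>J. c a j * y j) = 0"
      unfolding split t_def using k by simp
    moreover have "(\<Sum>j\<in>J. c i j * y j) = 0" if "i \<in> I" for i
    proof -
      have "0 = (\<Sum>j\<in>J'. d i j * x j)" using x(3) that by simp
      also have "\<dots> = (\<Sum>j\<in>J'. c i j * x j) - c i k / c a k * (\<Sum>j\<in>J'. c a j * x j)"
        unfolding d_def by (simp add: algebra_simps sum_subtractf sum_distrib_left)
      also have "\<dots> = (\<Sum>j\<in>J. c i j * y j)"
        unfolding split t_def by (simp add: field_simps)
      finally show ?thesis by simp
    qed
    moreover have "\<exists>j\<in>J. y j \<noteq> 0"
      using x(2) by (auto simp: y_def J'_def)
    moreover have "\<forall>j\<in>J. y j \<in> K"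
      using x(1) tK by (auto simp: y_def J'_def)
    ultimately show ?thesis by (intro exI[of _ y]) auto
  qed
qed

text \<open>A coordinate subspace with scalars restricted to \<open>S\<close>. Every space in the
  proof has this shape inside one type of vectors: the dimension is \<open>card I\<close>, splitting
  off a summand deletes indices, and extending scalars enlarges \<open>S\<close> while the form
  stays the same function.\<close>

definition coord_space :: "'a::field set \<Rightarrow> 'n set \<Rightarrow> ('a ^ 'n) set" where
  "coord_space S I = {x. \<forall>i. x $ i \<in> S \<and> (i \<notin> I \<longrightarrow> x $ i = 0)}"

definition linear_over :: "'a::field set \<Rightarrow> ('a ^ 'n) set \<Rightarrow> ('a ^ 'n \<Rightarrow> 'a ^ 'n) \<Rightarrow> bool" where
  "linear_over S V f \<longleftrightarrow> (\<forall>x\<in>V. \<forall>y\<in>V. f (x + y) = f x + f y) \<and> (\<forall>c\<in>S. \<forall>x\<in>V. f (c *s x) = c *s f x)"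

definition polar :: "('a::field ^ 'n \<Rightarrow> 'a) \<Rightarrow> 'a ^ 'n \<Rightarrow> 'a ^ 'n \<Rightarrow> 'a" where
  "polar q x y = q (x + y) - q x - q y"

text \<open>Only the coefficients are confined to \<open>K\<close>; the form is a function on all
  vectors, so the same \<open>q\<close> serves over \<open>K\<close> and over every larger
  field.\<close>

definition form_over :: "'a::field set \<Rightarrow> ('a ^ 'n \<Rightarrow> 'a) \<Rightarrow> bool" where
  "form_over K q \<longleftrightarrow> (\<exists>A. mat_in K A \<and> q = qf A)"

definition isometric_on :: "'a::field set \<Rightarrow> 'n set \<Rightarrow> 'n set \<Rightarrow> ('a ^ 'n \<Rightarrow> 'a) \<Rightarrow> ('a ^ 'n \<Rightarrow> 'a) \<Rightarrow> bool" where
  "isometric_on S I J q q' \<longleftrightarrow> (\<exists>f. linear_over S (coord_space S I) f \<and>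
     bij_betw f (coord_space S I) (coord_space S J) \<and> (\<forall>x\<in>coord_space S I. q' (f x) = q x))"

definition anisotropic :: "'a::field set \<Rightarrow> 'n set \<Rightarrow> ('a ^ 'n \<Rightarrow> 'a) \<Rightarrow> bool" where
  "anisotropic S I q \<longleftrightarrow> (\<forall>x\<in>coord_space S I. q x = 0 \<longrightarrow> x = 0)"

lemma coord_space_closed:
  assumes "is_subfield S"
  shows "0 \<in> coord_space S I"
    "\<And>x y. x \<in> coord_space S I \<Longrightarrow> y \<in> coord_space S I \<Longrightarrow> x + y \<in> coord_space S I"
    "\<And>x y. x \<in> coord_space S I \<Longrightarrow> y \<in> coord_space S I \<Longrightarrow> x - y \<in> coord_space S I"
    "\<And>x. x \<in> coord_space S I \<Longrightarrow> - x \<in> coord_space S I"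
    "\<And>c x. c \<in> S \<Longrightarrow> x \<in> coord_space S I \<Longrightarrow> c *s x \<in> coord_space S I"
    "\<And>i. i \<in> I \<Longrightarrow> axis i 1 \<in> coord_space S I"
    "\<And>f A. (\<And>a. a \<in> A \<Longrightarrow> f a \<in> coord_space S I) \<Longrightarrow> sum f A \<in> coord_space S I"
  by (auto simp: coord_space_def axis_def intro!: subfield_closed[OF assms] subfield_sum[OF assms] sum.neutral)

lemma coord_space_mono: "S \<subseteq> S' \<Longrightarrow> I \<subseteq> I' \<Longrightarrow> coord_space S I \<subseteq> coord_space S' I'"
  by (auto simp: coord_space_def)

lemma coord_space_expand:
  fixes x :: "'a::field ^ 'n::finite"
  assumes "x \<in> coord_space S I"
  shows "x = (\<Sum>i\<in>I. (x $ i) *s axis i 1)"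
proof -
  have "(\<Sum>i\<in>I. (x $ i) *s axis i 1) $ k = x $ k" for k
  proof -
    have "(\<Sum>i\<in>I. (x $ i) *s axis i (1::'a)) $ k = (\<Sum>i\<in>I. if i = k then x $ i else 0)"
      unfolding sum_component by (intro sum.cong) (auto simp: axis_def)
    also have "\<dots> = x $ k"
      using assms by (simp add: coord_space_def)
    finally show ?thesis .
  qed
  then show ?thesis by (simp add: vec_eq_iff)
qed

lemma linear_over_zero:
  assumes S: "is_subfield S" and f: "linear_over S (coord_space S I) f"
  shows "f 0 = 0"
proof -
  have "f (0 *s 0) = 0 *s f 0"
    using f subfield_closed(1)[OF S] coord_space_closed(1)[OF S, of I] unfolding linear_over_def by blast
  then show ?thesis by simp
qed

lemma linear_over_sum:
  assumes S: "is_subfield S" and f: "linear_over S (coord_space S I) f"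
    and "\<And>a. a \<in> A \<Longrightarrow> c a \<in> S" "\<And>a. a \<in> A \<Longrightarrow> x a \<in> coord_space S I"
  shows "f (\<Sum>a\<in>A. c a *s x a) = (\<Sum>a\<in>A. c a *s f (x a))"
  using assms(3-)
proof (induction A rule: infinite_finite_induct)
  case (insert a A)
  have "(\<Sum>a\<in>A. c a *s x a) \<in> coord_space S I"
    using insert by (auto intro!: coord_space_closed[OF S])
  then show ?case
    using insert f by (simp add: linear_over_def coord_space_closed[OF S])
qed (simp_all add: linear_over_zero[OF S f])

lemma linear_over_diff:
  assumes S: "is_subfield S" and f: "linear_over S (coord_space S I) f"
    and "x \<in> coord_space S I" "y \<in> coord_space S I"
  shows "f (x - y) = f x - f y"
proof -
  have "f x = f ((x - y) + y)" by simp
  also have "\<dots> = f (x - y) + f y"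
    using assms unfolding linear_over_def by (blast intro: coord_space_closed[OF S])
  finally show ?thesis by simp
qed

text \<open>Surjectivity comes from injectivity by counting: a relation between \<open>y\<close> and
  the images of the axes always exists, and the trivial kernel forces the coefficient of
  \<open>y\<close> in it to be nonzero.\<close>

lemma linear_over_bij:
  fixes f :: "'a::field ^ 'n::finite \<Rightarrow> 'a ^ 'n"
  assumes S: "is_subfield S" and f: "linear_over S (coord_space S I) f"
    and into: "\<And>x. x \<in> coord_space S I \<Longrightarrow> f x \<in> coord_space S J"
    and ker: "\<And>x. x \<in> coord_space S I \<Longrightarrow> f x = 0 \<Longrightarrow> x = 0"
    and card: "card I = card J"
  shows "bij_betw f (coord_space S I) (coord_space S J)"
  unfolding bij_betw_def
proof
  show "inj_on f (coord_space S I)"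
  proof (rule inj_onI)
    fix x y assume xy: "x \<in> coord_space S I" "y \<in> coord_space S I" "f x = f y"
    then have "f (x - y) = 0" using linear_over_diff[OF S f] by simp
    then have "x - y = 0" using ker xy by (blast intro: coord_space_closed[OF S])
    then show "x = y" by simp
  qed
  have "y \<in> f ` coord_space S I" if y: "y \<in> coord_space S J" for y
  proof -
    \<comment> \<open>The unknown \<open>None\<close> is the coefficient of \<open>y\<close>, the
      unknown \<open>Some i\<close> that of the image of the axis \<open>i\<close>; this is one
      unknown more than there are equations.\<close>
    define c where "c j k = (case k of None \<Rightarrow> y $ j | Some i \<Rightarrow> f (axis i 1) $ j)" for j k
    have "\<exists>x. (\<forall>k\<in>insert None (Some ` I). x k \<in> S) \<and> (\<exists>k\<in>insert None (Some ` I). x k \<noteq> 0) \<and>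
        (\<forall>j\<in>J. (\<Sum>k\<in>insert None (Some ` I). c j k * x k) = 0)"
    proof (rule homogeneous_system_solution[OF S])
      show "card J < card (insert None (Some ` I))"
        using card by (simp add: card_image)
      show "c j k \<in> S" if "j \<in> J" "k \<in> insert None (Some ` I)" for j k
        using that y into by (auto simp: c_def coord_space_def axis_def subfield_closed[OF S])
    qed auto
    then obtain x where x: "\<forall>k\<in>insert None (Some ` I). x k \<in> S"
        "\<exists>k\<in>insert None (Some ` I). x k \<noteq> 0"
        "\<forall>j\<in>J. (\<Sum>k\<in>insert None (Some ` I). c j k * x k) = 0" by blast
    define z where "z = (\<Sum>i\<in>I. x (Some i) *s axis i 1 :: 'a ^ 'n)"
    have zV: "z \<in> coord_space S I"
      unfolding z_def using x(1) by (auto intro!: coord_space_closed[OF S])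
    have fz: "f z = (\<Sum>i\<in>I. x (Some i) *s f (axis i 1))"
      unfolding z_def using x(1) by (intro linear_over_sum[OF S f]) (auto intro: coord_space_closed[OF S])
    have "x None *s y + f z = 0"
    proof -
      have "(x None *s y + f z) $ j = 0" for j
      proof (cases "j \<in> J")
        case True
        have "0 = (\<Sum>k\<in>insert None (Some ` I). c j k * x k)" using x(3) True by simp
        also have "\<dots> = y $ j * x None + (\<Sum>i\<in>I. f (axis i 1) $ j * x (Some i))"
          by (simp add: c_def sum.reindex)
        also have "\<dots> = (x None *s y + f z) $ j"
          unfolding fz by (simp add: mult.commute)
        finally show ?thesis by simp
      next
        case False
        then show ?thesis using y into[OF zV] by (auto simp: coord_space_def)
      qed
      then show ?thesis by (simp add: vec_eq_iff)
    qed
    have zi: "z $ i = x (Some i)" if "i \<in> I" for i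
      unfolding z_def using that by (simp add: axis_def if_distrib cong: if_cong)
    have t: "x None \<noteq> 0"
    proof
      assume 0: "x None = 0"
      with \<open>x None *s y + f z = 0\<close> have "f z = 0" by simp
      then have "z = 0" using ker zV by blast
      then have "\<forall>i\<in>I. x (Some i) = 0" using zi by auto
      with 0 x(2) show False by auto
    qed
    have "- inverse (x None) \<in> S"
      using x(1) by (auto intro!: subfield_closed[OF S])
    then have "f ((- inverse (x None)) *s z) = (- inverse (x None)) *s f z"
      using f zV unfolding linear_over_def by blast
    also have "f z = - (x None *s y)"
      using \<open>x None *s y + f z = 0\<close> by (simp add: eq_neg_iff_add_eq_0 add.commute)
    also have "(- inverse (x None)) *s - (x None *s y) = y"
      using t by (simp add: vec_eq_iff)
    finally show ?thesis
      using coord_space_closed(5)[OF S \<open>- inverse (x None) \<in> S\<close> zV] by (metis image_eqI)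
  qed
  then show "f ` coord_space S I = coord_space S J" using into by auto
qed

lemma isometric_onI:
  fixes f :: "'a::field ^ 'n::finite \<Rightarrow> 'a ^ 'n"
  assumes "is_subfield S" "linear_over S (coord_space S I) f"
    and "\<And>x. x \<in> coord_space S I \<Longrightarrow> f x \<in> coord_space S J"
    and "\<And>x. x \<in> coord_space S I \<Longrightarrow> f x = 0 \<Longrightarrow> x = 0"
    and "card I = card J"
    and "\<And>x. x \<in> coord_space S I \<Longrightarrow> q' (f x) = q x"
  shows "isometric_on S I J q q'"
  unfolding isometric_on_def using linear_over_bij[OF assms(1-5)] assms(2,6) by blast

lemma isometric_onE:
  assumes S: "is_subfield S" and "isometric_on S I J q q'"
  obtains f g where "linear_over S (coord_space S I) f" "linear_over S (coord_space S J) g"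
    "\<And>x. x \<in> coord_space S I \<Longrightarrow> f x \<in> coord_space S J"
    "\<And>x. x \<in> coord_space S J \<Longrightarrow> g x \<in> coord_space S I"
    "\<And>x. x \<in> coord_space S I \<Longrightarrow> g (f x) = x"
    "\<And>x. x \<in> coord_space S J \<Longrightarrow> f (g x) = x"
    "\<And>x. x \<in> coord_space S I \<Longrightarrow> q' (f x) = q x"
    "\<And>x. x \<in> coord_space S J \<Longrightarrow> q (g x) = q' x"
proof -
  obtain f where f: "linear_over S (coord_space S I) f"
      "bij_betw f (coord_space S I) (coord_space S J)" "\<forall>x\<in>coord_space S I. q' (f x) = q x"
    using assms unfolding isometric_on_def by blast
  define g where "g = the_inv_into (coord_space S I) f"
  have inj: "inj_on f (coord_space S I)" using f(2) by (simp add: bij_betw_def)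
  have fI: "f x \<in> coord_space S J" if "x \<in> coord_space S I" for x
    using f(2) that by (auto simp: bij_betw_def)
  have gJ: "g x \<in> coord_space S I" if "x \<in> coord_space S J" for x
    using bij_betw_the_inv_into[OF f(2)] that unfolding g_def by (auto simp: bij_betw_def)
  have gf: "g (f x) = x" if "x \<in> coord_space S I" for x
    unfolding g_def using the_inv_into_f_f[OF inj that] .
  have fg: "f (g x) = x" if "x \<in> coord_space S J" for x
    unfolding g_def using f_the_inv_into_f_bij_betw[OF f(2)] that by blast
  have "linear_over S (coord_space S J) g"
    unfolding linear_over_def
  proof (intro conjI ballI)
    fix x y assume xy: "x \<in> coord_space S J" "y \<in> coord_space S J"
    have "g (x + y) = g (f (g x + g y))"
      using f(1) xy gJ fg by (simp add: linear_over_def)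
    also have "\<dots> = g x + g y"
      using xy gJ by (intro gf coord_space_closed[OF S]) auto
    finally show "g (x + y) = g x + g y" .
  next
    fix c x assume xy: "c \<in> S" "x \<in> coord_space S J"
    have "g (c *s x) = g (f (c *s g x))"
      using f(1) xy gJ fg by (simp add: linear_over_def)
    also have "\<dots> = c *s g x"
      using xy gJ by (intro gf coord_space_closed[OF S]) auto
    finally show "g (c *s x) = c *s g x" .
  qed
  moreover have "q (g x) = q' x" if "x \<in> coord_space S J" for x
    using f(3) gJ[OF that] fg[OF that] by metis
  ultimately show thesis using that f(1,3) fI gJ gf fg by blast
qed

lemma isometric_on_sym:
  assumes "is_subfield S" "isometric_on S I J q q'"
  shows "isometric_on S J I q' q"
proof -
  from assms obtain f g where fg: "linear_over S (coord_space S J) g"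
    "\<And>x. x \<in> coord_space S I \<Longrightarrow> f x \<in> coord_space S J"
    "\<And>x. x \<in> coord_space S J \<Longrightarrow> g x \<in> coord_space S I"
    "\<And>x. x \<in> coord_space S I \<Longrightarrow> g (f x) = x"
    "\<And>x. x \<in> coord_space S J \<Longrightarrow> f (g x) = x"
    "\<And>x. x \<in> coord_space S J \<Longrightarrow> q (g x) = q' x"
    by (rule isometric_onE) blast
  then have "bij_betw g (coord_space S J) (coord_space S I)"
    by (intro bij_betw_byWitness[where f' = f]) auto
  then show ?thesis unfolding isometric_on_def using fg by blast
qed

lemma isometric_on_trans:
  assumes "isometric_on S I J q q'" "isometric_on S J L q' q''"
  shows "isometric_on S I L q q''"
proof -
  obtain f g where f: "linear_over S (coord_space S I) f" "bij_betw f (coord_space S I) (coord_space S J)"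
      "\<forall>x\<in>coord_space S I. q' (f x) = q x"
    and g: "linear_over S (coord_space S J) g" "bij_betw g (coord_space S J) (coord_space S L)"
      "\<forall>x\<in>coord_space S J. q'' (g x) = q' x"
    using assms unfolding isometric_on_def by blast
  have into: "f x \<in> coord_space S J" if "x \<in> coord_space S I" for x
    using f(2) that by (auto simp: bij_betw_def)
  have "linear_over S (coord_space S I) (g \<circ> f)"
    using f(1) g(1) into unfolding linear_over_def by simp
  moreover have "bij_betw (g \<circ> f) (coord_space S I) (coord_space S L)"
    using f(2) g(2) by (rule bij_betw_trans)
  moreover have "\<forall>x\<in>coord_space S I. q'' ((g \<circ> f) x) = q x"
    using f(3) g(3) into by simp
  ultimately show ?thesis unfolding isometric_on_def by blast
qed

lemma isometric_on_scale:
  assumes "isometric_on S I J q q'"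
  shows "isometric_on S I J (\<lambda>x. c * q x) (\<lambda>x. c * q' x)"
  using assms unfolding isometric_on_def by metis

section \<open>Polar forms and pulling back a form\<close>

lemma polar_qf:
  "polar (qf A) x y = (\<Sum>i\<in>UNIV. \<Sum>j\<in>UNIV. A $ i $ j * (x $ i * y $ j + y $ i * x $ j))"
  unfolding polar_def qf_def
  by (simp add: algebra_simps sum.distrib flip: sum_subtractf)

lemma form_over_polar:
  assumes "form_over K q"
  shows "q (x + y) = q x + q y + polar q x y"
    "q (c *s x) = c ^ 2 * q x" "q 0 = 0" "q (- x) = q x"
    "q (x - y) = q x + q y - polar q x y"
    "polar q x y = polar q y x"
    "polar q (x + x') y = polar q x y + polar q x' y"
    "polar q x (y + y') = polar q x y + polar q x y'"
    "polar q (x - x') y = polar q x y - polar q x' y"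
    "polar q x (y - y') = polar q x y - polar q x y'"
    "polar q (c *s x) y = c * polar q x y"
    "polar q x (c *s y) = c * polar q x y"
    "polar q 0 y = 0" "polar q x 0 = 0"
    "polar q x x = 2 * q x"
proof -
  obtain A where A: "q = qf A" using assms by (auto simp: form_over_def)
  show "q (x + y) = q x + q y + polar q x y" by (simp add: polar_def)
  show s: "q (c *s x) = c ^ 2 * q x" for c x
    unfolding A qf_def by (simp add: sum_distrib_left power2_eq_square algebra_simps)
  show "q 0 = 0" using s[of 0 0] by simp
  show m: "q (- x) = q x" for x using s[of "-1" x] by simp
  show sym: "polar q x y = polar q y x" for x y
    unfolding polar_def by (simp add: add.commute)
  show a: "polar q (x + x') y = polar q x y + polar q x' y" for x x' y
    unfolding A polar_qf by (simp add: algebra_simps sum.distrib)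
  then show a': "polar q x (y + y') = polar q x y + polar q x y'" for x y y'
    using sym by metis
  show c: "polar q (c *s x) y = c * polar q x y" for c x y
    unfolding A polar_qf by (simp add: sum_distrib_left algebra_simps)
  then show c': "polar q x (c *s y) = c * polar q x y" for c x y
    using sym by metis
  show d: "polar q (x - x') y = polar q x y - polar q x' y" for x x' y
    using a[of x "(-1) *s x'" y] c[of "-1" x' y] by simp
  then show "polar q x (y - y') = polar q x y - polar q x y'" for x y y'
    using sym by metis
  show "q (x - y) = q x + q y - polar q x y"
    using c'[of x "-1" y] m[of y] unfolding polar_def by simp
  show "polar q 0 y = 0" "polar q x 0 = 0" using c[of 0 0] c'[of _ 0 0] by simp_all
  have "x + x = 2 *s x" by (simp add: vec_eq_iff)
  then show "polar q x x = 2 * q x" using s[of 2 x] by (simp add: polar_def)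
qed

lemma form_over_mono: "form_over K q \<Longrightarrow> K \<subseteq> K' \<Longrightarrow> form_over K' q"
  unfolding form_over_def mat_in_def by blast

lemma form_over_scale:
  assumes "is_subfield K" "form_over K q" "c \<in> K"
  shows "form_over K (\<lambda>x. c * q x)"
proof -
  obtain A where A: "mat_in K A" "q = qf A" using assms by (auto simp: form_over_def)
  then have "mat_in K (qscale c A)" "(\<lambda>x. c * q x) = qf (qscale c A)"
    using assms by (auto simp: mat_in_def qscale_def qf_def sum_distrib_left algebra_simps
      intro!: subfield_closed[OF assms(1)])
  then show ?thesis by (auto simp: form_over_def)
qed

lemma form_over_closed:
  assumes K: "is_subfield K" and "form_over K q" "x \<in> coord_space K I"
  shows "q x \<in> K"
  using assms unfolding form_over_def qf_def coord_space_def mat_in_def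
  by (auto intro!: subfield_sum[OF K] subfield_closed[OF K])

lemma form_over_polar_closed:
  assumes K: "is_subfield K" and "form_over K q" "x \<in> coord_space K I" "y \<in> coord_space K I"
  shows "polar q x y \<in> K"
  unfolding polar_def
  using form_over_closed[OF K assms(2)] coord_space_closed(2)[OF K assms(3,4)] assms(3,4)
  by (blast intro: subfield_closed[OF K])

text \<open>The pulled-back form has the congruent matrix \<open>B\<close>, that is,
  \<open>A\<close> multiplied on both sides by the matrix of \<open>f\<close>. Its entries lie in
  \<open>K\<close> because the images of the axes do; the interchanges of sums only move the indices
  of the axes outward.\<close>

lemma form_over_comp:
  fixes f :: "'a::field ^ 'n::finite \<Rightarrow> 'a ^ 'n"
  assumes K: "is_subfield K" and "form_over K q" and f: "linear_over UNIV UNIV f"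
    and fK: "\<And>i. f (axis i 1) \<in> coord_space K UNIV"
  shows "form_over K (\<lambda>x. q (f x))"
proof -
  obtain A where A: "mat_in K A" "q = qf A" using assms by (auto simp: form_over_def)
  have UN: "coord_space UNIV UNIV = (UNIV :: ('a ^ 'n) set)" by (auto simp: coord_space_def)
  have fx: "f x $ i = (\<Sum>k\<in>UNIV. x $ k * f (axis k 1) $ i)" for x i
  proof -
    have "x = (\<Sum>i\<in>UNIV. x $ i *s axis i 1)"
      by (rule coord_space_expand[of _ UNIV]) (simp add: UN)
    then have "f x = f (\<Sum>i\<in>UNIV. x $ i *s axis i 1)" by simp
    also have "\<dots> = (\<Sum>i\<in>UNIV. x $ i *s f (axis i 1))"
      using f by (intro linear_over_sum[OF is_subfield_UNIV, of UNIV]) (auto simp: UN)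
    finally show ?thesis by simp
  qed
  define B where "B = (\<chi> k l. \<Sum>i\<in>UNIV. \<Sum>j\<in>UNIV. A $ i $ j * f (axis k 1) $ i * f (axis l 1) $ j)"
  have "q (f x) = qf B x" for x
  proof -
    define t where "t i j k l = A $ i $ j * f (axis k 1) $ i * f (axis l 1) $ j * x $ k * x $ l" for i j k l
    have "A $ i $ j * f x $ i * f x $ j = (\<Sum>k\<in>UNIV. \<Sum>l\<in>UNIV. t i j k l)" for i j
    proof -
      have "f x $ i * f x $ j = (\<Sum>k\<in>UNIV. \<Sum>l\<in>UNIV. (x $ k * f (axis k 1) $ i) * (x $ l * f (axis l 1) $ j))"
        unfolding fx[of x i] fx[of x j] by (rule sum_product)
      then have "A $ i $ j * f x $ i * f x $ j =
          A $ i $ j * (\<Sum>k\<in>UNIV. \<Sum>l\<in>UNIV. (x $ k * f (axis k 1) $ i) * (x $ l * f (axis l 1) $ j))"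
        by (simp add: mult.assoc)
      then show ?thesis
        unfolding sum_distrib_left t_def by (simp add: ac_simps)
    qed
    then have "q (f x) = (\<Sum>i\<in>UNIV. \<Sum>j\<in>UNIV. \<Sum>k\<in>UNIV. \<Sum>l\<in>UNIV. t i j k l)"
      unfolding A(2) qf_def by simp
    also have "\<dots> = (\<Sum>i\<in>UNIV. \<Sum>k\<in>UNIV. \<Sum>j\<in>UNIV. \<Sum>l\<in>UNIV. t i j k l)"
      by (intro sum.cong refl sum.swap)
    also have "\<dots> = (\<Sum>i\<in>UNIV. \<Sum>k\<in>UNIV. \<Sum>l\<in>UNIV. \<Sum>j\<in>UNIV. t i j k l)"
      by (intro sum.cong refl sum.swap)
    also have "\<dots> = (\<Sum>k\<in>UNIV. \<Sum>i\<in>UNIV. \<Sum>l\<in>UNIV. \<Sum>j\<in>UNIV. t i j k l)"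
      by (rule sum.swap)
    also have "\<dots> = (\<Sum>k\<in>UNIV. \<Sum>l\<in>UNIV. \<Sum>i\<in>UNIV. \<Sum>j\<in>UNIV. t i j k l)"
      by (intro sum.cong refl sum.swap)
    also have "\<dots> = qf B x"
      unfolding qf_def B_def t_def by (simp add: sum_distrib_right)
    finally show ?thesis .
  qed
  moreover have "mat_in K B"
    using A(1) fK unfolding mat_in_def B_def coord_space_def
    by (auto intro!: subfield_sum[OF K] subfield_closed[OF K])
  ultimately show ?thesis by (auto simp: form_over_def)
qed

section \<open>Polynomials over a subfield and simple extensions\<close>

definition poly_over :: "'a::field set \<Rightarrow> 'a poly set" where
  "poly_over K = {f. \<forall>i. coeff f i \<in> K}"

lemma poly_over_closed:
  assumes K: "is_subfield K"
  shows "0 \<in> poly_over K" "1 \<in> poly_over K"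
    "\<And>c. c \<in> K \<Longrightarrow> [:c:] \<in> poly_over K"
    "\<And>c n. c \<in> K \<Longrightarrow> monom c n \<in> poly_over K"
    "\<And>f g. f \<in> poly_over K \<Longrightarrow> g \<in> poly_over K \<Longrightarrow> f + g \<in> poly_over K"
    "\<And>f g. f \<in> poly_over K \<Longrightarrow> g \<in> poly_over K \<Longrightarrow> f - g \<in> poly_over K"
    "\<And>f g. f \<in> poly_over K \<Longrightarrow> g \<in> poly_over K \<Longrightarrow> f * g \<in> poly_over K"
    "\<And>f c. c \<in> K \<Longrightarrow> f \<in> poly_over K \<Longrightarrow> smult c f \<in> poly_over K"
    "\<And>f c. c \<in> K \<Longrightarrow> f \<in> poly_over K \<Longrightarrow> pCons c f \<in> poly_over K"
  by (auto simp: poly_over_def coeff_mult coeff_pCons split: nat.split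
      intro!: subfield_closed[OF K] subfield_sum[OF K])

lemma poly_over_sum:
  assumes K: "is_subfield K" and "\<And>i. i \<in> I \<Longrightarrow> f i \<in> poly_over K"
  shows "sum f I \<in> poly_over K"
  using assms(2) by (induction I rule: infinite_finite_induct) (auto intro: poly_over_closed[OF K])

lemma poly_over_eval:
  assumes K: "is_subfield K" and "f \<in> poly_over K" "x \<in> K"
  shows "poly f x \<in> K"
  unfolding poly_altdef using assms
  by (auto intro!: subfield_sum[OF K] subfield_closed[OF K] simp: poly_over_def)

lemma poly_over_division:
  fixes g :: "'a::field poly"
  assumes K: "is_subfield K" and g: "g \<in> poly_over K" "g \<noteq> 0" and "f \<in> poly_over K"
  shows "\<exists>a\<in>poly_over K. \<exists>r\<in>poly_over K. f = a * g + r \<and> (r = 0 \<or> degree r < degree g)"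
  using assms(4)
proof (induction "degree f" arbitrary: f rule: less_induct)
  case less
  show ?case
  proof (cases "f = 0 \<or> degree f < degree g")
    case True
    then show ?thesis using less.prems
      by (intro bexI[of _ 0] bexI[of _ f]) (auto intro: poly_over_closed[OF K])
  next
    case False
    define m where "m = monom (lead_coeff f / lead_coeff g) (degree f - degree g)"
    have m: "m \<in> poly_over K"
      unfolding m_def using less.prems g
      by (intro poly_over_closed[OF K] subfield_closed[OF K]) (auto simp: poly_over_def)
    define h where "h = f - m * g"
    have h: "h \<in> poly_over K" unfolding h_def
      by (intro poly_over_closed[OF K] less.prems m g)
    have lc: "lead_coeff f / lead_coeff g \<noteq> 0" using False g by auto
    have dm: "degree (m * g) = degree f"
      using False g lc by (subst degree_mult_eq) (auto simp: m_def degree_monom_eq)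
    have ch: "coeff h (degree f) = 0"
    proof -
      have "coeff (m * g) (degree f) = lead_coeff (m * g)" using dm by simp
      also have "\<dots> = lead_coeff m * lead_coeff g" by (rule lead_coeff_mult)
      also have "lead_coeff m = lead_coeff f / lead_coeff g"
        using lc unfolding m_def by (simp add: degree_monom_eq)
      finally show ?thesis unfolding h_def using g by simp
    qed
    have dh: "degree h \<le> degree f"
      unfolding h_def using dm by (intro degree_diff_le) auto
    show ?thesis
    proof (cases "degree h < degree f")
      case True
      then obtain a r where ar: "a \<in> poly_over K" "r \<in> poly_over K" "h = a * g + r" "r = 0 \<or> degree r < degree g"
        using less.hyps h by blast
      then have "f = (a + m) * g + r" unfolding h_def by (simp add: algebra_simps)
      then show ?thesis using ar m poly_over_closed(5)[OF K] by blast
    next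
      case False
      then have "degree h = degree f" using dh by simp
      then have "h = 0" using ch by (metis leading_coeff_0_iff)
      then have "f = m * g + 0" unfolding h_def by simp
      then show ?thesis using m poly_over_closed(1)[OF K] by blast
    qed
  qed
qed

text \<open>A nonzero element \<open>d\<close> of least degree in the ideal of \<open>f\<close> and
  \<open>g\<close> divides both, since the remainder of a division by \<open>d\<close> lies in the
  ideal again. Coprimality is stated by common divisors with cofactors over \<open>K\<close>, the
  form in which irreducibility and primitivity supply it later.\<close>

lemma poly_over_bezout:
  assumes K: "is_subfield K" and fg: "f \<in> poly_over K" "g \<in> poly_over K" "g \<noteq> 0"
    and coprime: "\<And>d a b. d \<in> poly_over K \<Longrightarrow> a \<in> poly_over K \<Longrightarrow> b \<in> poly_over K \<Longrightarrow>
      f = a * d \<Longrightarrow> g = b * d \<Longrightarrow> degree d = 0"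
  shows "\<exists>u\<in>poly_over K. \<exists>v\<in>poly_over K. u * f + v * g = 1"
proof -
  define P where "P d \<longleftrightarrow> d \<noteq> 0 \<and> (\<exists>u\<in>poly_over K. \<exists>v\<in>poly_over K. d = u * f + v * g)" for d
  have "g = 0 * f + 1 * g" by simp
  then have "P g" unfolding P_def using fg(3) poly_over_closed(1,2)[OF K] by blast
  then obtain d where d: "P d" and min: "\<And>e. P e \<Longrightarrow> degree d \<le> degree e"
    using ex_has_least_nat[of P g degree] by blast
  obtain u v where uv: "u \<in> poly_over K" "v \<in> poly_over K" "d = u * f + v * g" and d0: "d \<noteq> 0"
    using d unfolding P_def by blast
  have dK: "d \<in> poly_over K" unfolding uv(3) by (intro poly_over_closed[OF K] uv fg)
  have dvd: "\<exists>a\<in>poly_over K. h = a * d"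
    if h: "h \<in> poly_over K" "h = s * f + t * g" "s \<in> poly_over K" "t \<in> poly_over K" for h s t
  proof -
    obtain a r where ar: "a \<in> poly_over K" "r \<in> poly_over K" "h = a * d + r" "r = 0 \<or> degree r < degree d"
      using poly_over_division[OF K dK d0 h(1)] by blast
    have "r = (s - a * u) * f + (t - a * v) * g"
      using ar(3) h(2) uv(3) by (simp add: algebra_simps)
    moreover have "s - a * u \<in> poly_over K" "t - a * v \<in> poly_over K"
      by (intro poly_over_closed[OF K] h uv ar)+
    ultimately have "r = 0 \<or> P r" unfolding P_def by blast
    then have "r = 0" using min ar(4) by fastforce
    then show ?thesis using ar by auto
  qed
  obtain a where a: "a \<in> poly_over K" "f = a * d"
    using dvd[of f 1 0] fg poly_over_closed(1,2)[OF K] by auto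
  obtain b where b: "b \<in> poly_over K" "g = b * d"
    using dvd[of g 0 1] fg poly_over_closed(1,2)[OF K] by auto
  have "degree d = 0" using coprime dK a b by blast
  then obtain c where c: "d = [:c:]" by (metis degree_eq_zeroE)
  have cK: "inverse c \<in> K"
    using dK unfolding c poly_over_def by (auto intro!: subfield_closed[OF K] dest: spec[of _ 0])
  have "smult (inverse c) u * f + smult (inverse c) v * g = smult (inverse c) d"
    unfolding uv(3) by (simp add: smult_add_right)
  also have "\<dots> = 1" using d0 unfolding c by (simp add: one_pCons)
  finally show ?thesis
    using poly_over_closed(8)[OF K cK uv(1)] poly_over_closed(8)[OF K cK uv(2)] by blast
qed

lemma min_polyD:
  assumes "is_min_poly K l p"
  shows "p \<in> poly_over K" "p \<noteq> 0" "poly p l = 0" "lead_coeff p = 1" "degree p > 0"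
    "\<And>f. f \<in> poly_over K \<Longrightarrow> poly f l = 0 \<Longrightarrow> degree f < degree p \<Longrightarrow> f = 0"
proof -
  show "p \<in> poly_over K" and z: "poly p l = 0" and lc: "lead_coeff p = 1"
    using assms by (auto simp: is_min_poly_def poly_over_def)
  then show n0: "p \<noteq> 0" by auto
  show "degree p > 0"
    using z n0 by (metis degree_eq_zeroE gr0I mult_zero_right poly_0 poly_pCons pCons_0_0 add_0_right)
  show "f = 0" if "f \<in> poly_over K" "poly f l = 0" "degree f < degree p" for f
  proof (rule ccontr)
    assume "f \<noteq> 0"
    then have "degree p \<le> degree f"
      using assms that(1,2) unfolding is_min_poly_def poly_over_def by blast
    then show False using that(3) by simp
  qed
qed

lemma min_poly_dvd:
  assumes K: "is_subfield K" and p: "is_min_poly K l p" and f: "f \<in> poly_over K" "poly f l = 0"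
  shows "\<exists>a\<in>poly_over K. f = a * p"
proof -
  obtain a r where ar: "a \<in> poly_over K" "r \<in> poly_over K" "f = a * p + r" "r = 0 \<or> degree r < degree p"
    using poly_over_division[OF K min_polyD(1,2)[OF p] f(1)] by blast
  have "poly r l = 0" using f(2) ar(3) min_polyD(3)[OF p] by simp
  then have "r = 0" using ar(2,4) min_polyD(6)[OF p] by blast
  then show ?thesis using ar by auto
qed

lemma min_poly_irreducible:
  assumes p: "is_min_poly K l p" and "a \<in> poly_over K" "b \<in> poly_over K" "p = a * b"
  shows "degree a = 0 \<or> degree b = 0"
proof (rule ccontr)
  assume "\<not> ?thesis"
  moreover have "a \<noteq> 0" "b \<noteq> 0" using assms min_polyD(2)[OF p] by auto
  moreover from this have "degree p = degree a + degree b"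
    using assms(4) by (simp add: degree_mult_eq)
  moreover have "poly a l = 0 \<or> poly b l = 0" using min_polyD(3)[OF p] assms(4) by simp
  ultimately show False using min_polyD(6)[OF p] assms(2,3) by fastforce
qed

text \<open>If the constant term vanished, dividing \<open>p\<close> by X would leave a nonzero
  polynomial of smaller degree that still vanishes at \<open>l\<close>, because \<open>l\<close> is
  not zero.\<close>

lemma min_poly_const_nonzero:
  assumes K: "is_subfield K" and p: "is_min_poly K l p" and "l \<noteq> 0"
  shows "coeff p 0 \<noteq> 0" "coeff p 0 \<in> K"
proof -
  show "coeff p 0 \<in> K" using min_polyD(1)[OF p] by (simp add: poly_over_def)
  show "coeff p 0 \<noteq> 0"
  proof
    assume 0: "coeff p 0 = 0"
    obtain a f where f: "p = pCons a f" by (cases p)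
    with 0 have a: "a = 0" by simp
    have "f \<noteq> 0" using f a min_polyD(2)[OF p] by auto
    moreover have "coeff f i \<in> K" for i
      using min_polyD(1)[OF p] f by (auto simp: poly_over_def coeff_pCons dest: spec[of _ "Suc i"])
    moreover have "poly f l = 0" using min_polyD(3)[OF p] f a assms(3) by simp
    moreover have "degree f < degree p" using f \<open>f \<noteq> 0\<close> by simp
    ultimately show False using min_polyD(6)[OF p] by (auto simp: poly_over_def)
  qed
qed

text \<open>Polynomial values suffice for K(l): once \<open>l\<close> has a minimal polynomial, the
  ring K[l] is already a field.\<close>

definition adjoin :: "'a::field set \<Rightarrow> 'a \<Rightarrow> 'a set" where
  "adjoin K l = (\<lambda>f. poly f l) ` poly_over K"

lemma adjoin_base:
  assumes K: "is_subfield K"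
  shows "K \<subseteq> adjoin K l" "l \<in> adjoin K l"
proof
  fix c assume "c \<in> K"
  then show "c \<in> adjoin K l" unfolding adjoin_def
    by (intro image_eqI[of _ _ "[:c:]"]) (auto intro: poly_over_closed[OF K])
next
  show "l \<in> adjoin K l" unfolding adjoin_def
    by (intro image_eqI[of _ _ "[:0,1:]"]) (auto intro!: poly_over_closed[OF K] subfield_closed[OF K])
qed

lemma adjoin_reduced:
  assumes K: "is_subfield K" and p: "is_min_poly K l p" and "e \<in> adjoin K l"
  shows "\<exists>f\<in>poly_over K. degree f < degree p \<and> poly f l = e"
proof -
  obtain f where f: "f \<in> poly_over K" "e = poly f l" using assms by (auto simp: adjoin_def)
  obtain a r where ar: "a \<in> poly_over K" "r \<in> poly_over K" "f = a * p + r" "r = 0 \<or> degree r < degree p"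
    using poly_over_division[OF K min_polyD(1,2)[OF p] f(1)] by blast
  then show ?thesis using f(2) min_polyD(3,5)[OF p] by (intro bexI[of _ r]) auto
qed

text \<open>For inverses, take a representative \<open>f\<close> of degree below that of
  \<open>p\<close>. Irreducibility makes it coprime to \<open>p\<close>, and its Bezout coefficient
  evaluated at \<open>l\<close> is the inverse.\<close>

lemma adjoin_subfield:
  assumes K: "is_subfield K" and p: "is_min_poly K l p"
  shows "is_subfield (adjoin K l)"
  unfolding is_subfield_def
proof (intro conjI ballI impI)
  show "0 \<in> adjoin K l" "1 \<in> adjoin K l"
    using adjoin_base(1)[OF K] subfield_closed[OF K] by auto
  fix x y assume "x \<in> adjoin K l" "y \<in> adjoin K l"
  then obtain f g where fg: "f \<in> poly_over K" "g \<in> poly_over K" "x = poly f l" "y = poly g l"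
    by (auto simp: adjoin_def)
  show "x + y \<in> adjoin K l" unfolding adjoin_def
    by (rule image_eqI[of _ _ "f + g"]) (auto simp: fg intro!: poly_over_closed[OF K])
  show "x - y \<in> adjoin K l" unfolding adjoin_def
    by (rule image_eqI[of _ _ "f - g"]) (auto simp: fg intro!: poly_over_closed[OF K])
  show "x * y \<in> adjoin K l" unfolding adjoin_def
    by (rule image_eqI[of _ _ "f * g"]) (auto simp: fg intro!: poly_over_closed[OF K])
next
  fix x assume x: "x \<in> adjoin K l" "x \<noteq> 0"
  then obtain f where f: "f \<in> poly_over K" "degree f < degree p" "x = poly f l"
    using adjoin_reduced[OF K p] by metis
  have "\<exists>u\<in>poly_over K. \<exists>v\<in>poly_over K. u * f + v * p = 1"
  proof (rule poly_over_bezout[OF K f(1) min_polyD(1,2)[OF p]])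
    fix d a b assume d: "d \<in> poly_over K" "a \<in> poly_over K" "b \<in> poly_over K" "f = a * d" "p = b * d"
    have "f \<noteq> 0" using f x by auto
    then have "degree d \<le> degree f" using d(4) by (auto simp: degree_mult_eq)
    moreover have "degree p = degree b + degree d"
      using d(5) min_polyD(2)[OF p] by (auto simp: degree_mult_eq)
    ultimately show "degree d = 0"
      using min_poly_irreducible[OF p d(3,1,5)] f(2) by auto
  qed
  then obtain u v where uv: "u \<in> poly_over K" "u * f + v * p = 1" by blast
  have "poly (u * f + v * p) l = 1" unfolding uv by simp
  then have "poly u l * x = 1" using min_polyD(3)[OF p] f by simp
  then have "inverse x = poly u l" using x by (simp add: field_simps)
  then show "inverse x \<in> adjoin K l" unfolding adjoin_def using uv by blast
qed

section \<open>Degrees and the tower law\<close>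

definition field_basis :: "'a::field set \<Rightarrow> 'i set \<Rightarrow> ('i \<Rightarrow> 'a) \<Rightarrow> bool" where
  "field_basis K I b \<longleftrightarrow> finite I \<and>
    (\<forall>c. (\<forall>i\<in>I. c i \<in> K) \<and> (\<Sum>i\<in>I. c i * b i) = 0 \<longrightarrow> (\<forall>i\<in>I. c i = 0)) \<and>
    (\<forall>y. \<exists>c. (\<forall>i\<in>I. c i \<in> K) \<and> y = (\<Sum>i\<in>I. c i * b i))"

text \<open>Bases are families over index sets, so that sub-families and products of bases can be
  formed; the index type is fixed to \<open>nat\<close> here so that no free index type is left
  over.\<close>

definition has_degree :: "'a::field set \<Rightarrow> nat \<Rightarrow> bool" where
  "has_degree K N \<longleftrightarrow> (\<exists>(I :: nat set) b. field_basis K I b \<and> card I = N)"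

text \<open>Expanding each \<open>v j\<close> in the basis turns a linear relation into
  \<open>card I\<close> equations in \<open>card J\<close> unknowns.\<close>

lemma field_basis_dependent:
  assumes K: "is_subfield K" and b: "field_basis K I b" and J: "finite J" "card I < card J"
  shows "\<exists>x. (\<forall>j\<in>J. x j \<in> K) \<and> (\<exists>j\<in>J. x j \<noteq> 0) \<and> (\<Sum>j\<in>J. x j * v j) = 0"
proof -
  have "\<forall>j. \<exists>c. (\<forall>i\<in>I. c i \<in> K) \<and> v j = (\<Sum>i\<in>I. c i * b i)"
    using b by (simp add: field_basis_def)
  then obtain c where c: "\<And>i j. i \<in> I \<Longrightarrow> c j i \<in> K" "\<And>j. v j = (\<Sum>i\<in>I. c j i * b i)"
    by metis
  have "finite I" using b by (simp add: field_basis_def)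
  then have "\<exists>x. (\<forall>j\<in>J. x j \<in> K) \<and> (\<exists>j\<in>J. x j \<noteq> 0) \<and> (\<forall>i\<in>I. (\<Sum>j\<in>J. c j i * x j) = 0)"
    by (rule homogeneous_system_solution[OF K _ J]) (rule c(1))
  then obtain x where x: "\<forall>j\<in>J. x j \<in> K" "\<exists>j\<in>J. x j \<noteq> 0" "\<forall>i\<in>I. (\<Sum>j\<in>J. c j i * x j) = 0"
    by blast
  have "(\<Sum>j\<in>J. x j * v j) = (\<Sum>j\<in>J. \<Sum>i\<in>I. x j * (c j i * b i))"
    unfolding c(2) by (simp add: sum_distrib_left)
  also have "\<dots> = (\<Sum>i\<in>I. \<Sum>j\<in>J. x j * (c j i * b i))" by (rule sum.swap)
  also have "\<dots> = (\<Sum>i\<in>I. (\<Sum>j\<in>J. c j i * x j) * b i)"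
    by (simp add: sum_distrib_left sum_distrib_right mult_ac)
  also have "\<dots> = 0" using x(3) by simp
  finally show ?thesis using x by blast
qed

lemma field_basis_card_eq:
  assumes K: "is_subfield K" and "field_basis K I b" "field_basis K J c"
  shows "card I = card J"
proof (rule ccontr)
  have *: "\<not> card I < card J" if "field_basis K I b" "field_basis K J c"
    for I :: "'i set" and J :: "'j set" and b c
    using field_basis_dependent[OF K that(1), of J c] that(2) unfolding field_basis_def by blast
  have **: "\<not> card J < card I" if "field_basis K I b" "field_basis K J c"
    for I :: "'i set" and J :: "'j set" and b c
    using field_basis_dependent[OF K that(2), of I b] that(1) unfolding field_basis_def by blast
  assume "card I \<noteq> card J"
  then show False using *[OF assms(2,3)] **[OF assms(2,3)] by linarith
qed

text \<open>The \<open>N + 1\<close> powers of \<open>l\<close> up to exponent \<open>N\<close> are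
  linearly dependent over \<open>K\<close>, so some nonzero polynomial vanishes at \<open>l\<close>;
  one of least degree is made monic.\<close>

lemma min_poly_exists:
  assumes K: "is_subfield K" and "has_degree K N"
  shows "\<exists>p. is_min_poly K l p"
proof -
  obtain I :: "nat set" and b where b: "field_basis K I b" "card I = N"
    using assms by (auto simp: has_degree_def)
  obtain x where x: "\<forall>j\<in>{..N}. x j \<in> K" "\<exists>j\<in>{..N}. x j \<noteq> 0" "(\<Sum>j\<in>{..N}. x j * l ^ j) = 0"
    using field_basis_dependent[OF K b(1), of "{..N}" "\<lambda>j. l ^ j"] b(2) by auto
  define P where "P f \<longleftrightarrow> f \<noteq> 0 \<and> (\<forall>i. coeff f i \<in> K) \<and> poly f l = 0" for f
  define f where "f = (\<Sum>j\<le>N. monom (x j) j)"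
  have cf: "coeff f j = (if j \<le> N then x j else 0)" for j
    unfolding f_def coeff_sum coeff_monom by (simp add: if_distrib sum.If_cases cong: if_cong)
  have "P f"
    unfolding P_def
  proof (intro conjI allI)
    show "f \<noteq> 0" using x(2) cf by (metis atMost_iff coeff_0)
    show "coeff f i \<in> K" for i using x(1) cf subfield_closed(1)[OF K] by auto
    show "poly f l = 0" using x(3) by (simp add: f_def poly_sum poly_monom)
  qed
  then obtain g where g: "P g" "\<And>h. P h \<Longrightarrow> degree g \<le> degree h"
    using ex_has_least_nat[of P f degree] by blast
  define p where "p = smult (inverse (lead_coeff g)) g"
  have "degree p = degree g" "lead_coeff p = 1" using g(1) by (auto simp: p_def P_def)
  moreover have "\<forall>i. coeff p i \<in> K" "poly p l = 0"
    using g(1) by (auto simp: p_def P_def intro!: subfield_closed[OF K])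
  ultimately have "is_min_poly K l p"
    using g(2) unfolding is_min_poly_def P_def by metis
  then show ?thesis ..
qed

lemma min_poly_power_basis:
  assumes K: "is_subfield K" and p: "is_min_poly K l p"
    and c: "\<And>k. k < degree p \<Longrightarrow> c k \<in> K" and z: "(\<Sum>k<degree p. c k * l ^ k) = 0" and "k < degree p"
  shows "c k = 0"
proof -
  define f where "f = (\<Sum>k<degree p. monom (c k) k)"
  have cf: "coeff f j = (if j < degree p then c j else 0)" for j
    unfolding f_def coeff_sum coeff_monom by (simp add: if_distrib sum.If_cases cong: if_cong)
  have "f \<in> poly_over K"
    using c cf subfield_closed(1)[OF K] by (simp add: poly_over_def)
  moreover have "poly f l = 0" using z by (simp add: f_def poly_sum poly_monom)
  moreover have "degree f < degree p"
    using cf min_polyD(5)[OF p] by (intro degree_lessI) auto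
  ultimately have "f = 0" using min_polyD(6)[OF p] by blast
  then show ?thesis using cf[of k] assms(5) by simp
qed

text \<open>A basis over K(l) is found inside the given basis over \<open>K\<close>; its products
  with the powers of \<open>l\<close> below \<open>degree p\<close> form another basis over
  \<open>K\<close>, and the two bases over \<open>K\<close> have the same size.\<close>

lemma degree_tower:
  assumes K: "is_subfield K" and N: "has_degree K N" and p: "is_min_poly K l p"
  shows "\<exists>M. has_degree (adjoin K l) M \<and> N = degree p * M"
proof -
  let ?E = "adjoin K l"
  have E: "is_subfield ?E" by (rule adjoin_subfield[OF K p])
  obtain I :: "nat set" and b where b: "field_basis K I b" "card I = N"
    using N by (auto simp: has_degree_def)
  have fI: "finite I" using b by (simp add: field_basis_def)
  \<comment> \<open>A minimal spanning subset is independent: a relation over K(l) with a nonzero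
    coefficient at \<open>j\<close> would allow \<open>j\<close> to be dropped.\<close>
  define spans where "spans J \<longleftrightarrow> J \<subseteq> I \<and> (\<forall>y. \<exists>c. (\<forall>i\<in>J. c i \<in> ?E) \<and> y = (\<Sum>i\<in>J. c i * b i))" for J
  have "spans I"
    unfolding spans_def
  proof (intro conjI allI subset_refl)
    fix y
    obtain c where "\<forall>i\<in>I. c i \<in> K" "y = (\<Sum>i\<in>I. c i * b i)"
      using b(1) unfolding field_basis_def by metis
    then show "\<exists>c. (\<forall>i\<in>I. c i \<in> ?E) \<and> y = (\<Sum>i\<in>I. c i * b i)"
      using adjoin_base(1)[OF K, of l] by (intro exI[of _ c]) auto
  qed
  then have "{J. spans J} \<noteq> {}" by auto
  moreover have "finite {J. spans J}"
    by (rule finite_subset[of _ "Pow I"]) (auto simp: spans_def fI)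
  ultimately obtain J where J: "spans J" "\<And>J'. spans J' \<Longrightarrow> J' \<subseteq> J \<Longrightarrow> J = J'"
    using finite_has_minimal[of "{J. spans J}"] by auto
  have fJ: "finite J" using J(1) fI by (auto simp: spans_def intro: finite_subset)
  have indep: "c j = 0" if c: "\<forall>i\<in>J. c i \<in> ?E" "(\<Sum>i\<in>J. c i * b i) = 0" "j \<in> J" for c j
  proof (rule ccontr)
    assume cj: "c j \<noteq> 0"
    have bj: "b j = - (\<Sum>i\<in>J - {j}. c i * b i) / c j"
      using c(2) cj sum.remove[OF fJ c(3), of "\<lambda>i. c i * b i"] by (simp add: field_simps add_eq_0_iff)
    have "spans (J - {j})"
      unfolding spans_def
    proof (intro conjI allI)
      show "J - {j} \<subseteq> I" using J(1) by (auto simp: spans_def)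
      fix y
      obtain d where d: "\<forall>i\<in>J. d i \<in> ?E" "y = (\<Sum>i\<in>J. d i * b i)"
        using J(1) unfolding spans_def by metis
      have "y = d j * b j + (\<Sum>i\<in>J - {j}. d i * b i)"
        unfolding d(2) using sum.remove[OF fJ c(3)] .
      also have "\<dots> = (\<Sum>i\<in>J - {j}. (d i - d j / c j * c i) * b i)"
        unfolding bj by (simp add: algebra_simps sum_subtractf sum_distrib_left sum_distrib_right sum_divide_distrib)
      finally show "\<exists>c. (\<forall>i\<in>J - {j}. c i \<in> ?E) \<and> y = (\<Sum>i\<in>J - {j}. c i * b i)"
        using c(1,3) d(1)
        by (intro exI[of _ "\<lambda>i. d i - d j / c j * c i"] conjI ballI subfield_closed[OF E]) auto
    qed
    then show False using J(2)[of "J - {j}"] c(3) by auto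
  qed
  have basisE: "field_basis ?E J b"
    unfolding field_basis_def using fJ indep J(1) by (auto simp: spans_def)
  define n where "n = degree p"
  have "field_basis K ({..<n} \<times> J) (\<lambda>(k, j). l ^ k * b j)"
    unfolding field_basis_def
  proof (intro conjI allI impI ballI)
    show "finite ({..<n} \<times> J)" using fJ by simp
  next
    fix c kj
    assume c: "(\<forall>i\<in>{..<n} \<times> J. c i \<in> K) \<and> (\<Sum>i\<in>{..<n} \<times> J. c i * (case i of (k, j) \<Rightarrow> l ^ k * b j)) = 0"
      and "kj \<in> {..<n} \<times> J"
    then obtain k j where kj: "kj = (k, j)" "k < n" "j \<in> J" by auto
    have "0 = (\<Sum>(k, j)\<in>{..<n} \<times> J. c (k, j) * (l ^ k * b j))"
      using conjunct2[OF c] by (simp add: case_prod_unfold)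
    also have "\<dots> = (\<Sum>j\<in>J. \<Sum>k<n. c (k, j) * (l ^ k * b j))"
      by (subst sum.cartesian_product[symmetric]) (rule sum.swap)
    also have "\<dots> = (\<Sum>j\<in>J. (\<Sum>k<n. c (k, j) * l ^ k) * b j)"
      by (simp add: sum_distrib_right mult.assoc)
    finally have "(\<Sum>j\<in>J. (\<Sum>k<n. c (k, j) * l ^ k) * b j) = 0" by simp
    moreover have "\<forall>j\<in>J. (\<Sum>k<n. c (k, j) * l ^ k) \<in> ?E"
      using conjunct1[OF c] adjoin_base[OF K, of l]
      by (intro ballI subfield_sum[OF E] subfield_closed[OF E]) auto
    ultimately have "(\<Sum>k<n. c (k, j) * l ^ k) = 0"
      by (intro indep[of "\<lambda>j. \<Sum>k<n. c (k, j) * l ^ k", OF _ _ kj(3)])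
    moreover have "c (k, j) \<in> K" if "k < degree p" for k
      using c kj(3) that unfolding n_def by blast
    ultimately have "c (k, j) = 0"
      using kj(2) unfolding n_def by (intro min_poly_power_basis[OF K p, of "\<lambda>k. c (k, j)"])
    then show "c kj = 0" using kj(1) by simp
  next
    fix y
    obtain d where d: "\<forall>j\<in>J. d j \<in> ?E" "y = (\<Sum>j\<in>J. d j * b j)"
      using J(1) unfolding spans_def by metis
    have "\<forall>j\<in>J. \<exists>f. f \<in> poly_over K \<and> degree f < n \<and> poly f l = d j"
      using adjoin_reduced[OF K p] d(1) unfolding n_def by blast
    then obtain f where f: "\<And>j. j \<in> J \<Longrightarrow> f j \<in> poly_over K" "\<And>j. j \<in> J \<Longrightarrow> degree (f j) < n"
        "\<And>j. j \<in> J \<Longrightarrow> poly (f j) l = d j" by metis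
    have dj: "d j = (\<Sum>k<n. coeff (f j) k * l ^ k)" if "j \<in> J" for j
    proof -
      have "d j = (\<Sum>k\<le>degree (f j). coeff (f j) k * l ^ k)"
        using f(3)[OF that] by (simp add: poly_altdef)
      also have "\<dots> = (\<Sum>k<n. coeff (f j) k * l ^ k)"
        using f(2)[OF that] by (intro sum.mono_neutral_left) (auto simp: coeff_eq_0)
      finally show ?thesis .
    qed
    have "y = (\<Sum>j\<in>J. \<Sum>k<n. coeff (f j) k * (l ^ k * b j))"
      unfolding d(2) by (intro sum.cong refl) (simp add: dj sum_distrib_right mult.assoc)
    also have "\<dots> = (\<Sum>(k, j)\<in>{..<n} \<times> J. coeff (f j) k * (l ^ k * b j))"
      by (subst sum.cartesian_product[symmetric]) (rule sum.swap)
    finally show "\<exists>c. (\<forall>i\<in>{..<n} \<times> J. c i \<in> K) \<and> y = (\<Sum>i\<in>{..<n} \<times> J. c i * (case i of (k, j) \<Rightarrow> l ^ k * b j))"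
      using f(1) by (intro exI[of _ "\<lambda>(k, j). coeff (f j) k"]) (auto simp: poly_over_def case_prod_unfold)
  qed
  then have "card I = card ({..<n} \<times> J)" using field_basis_card_eq[OF K b(1)] by blast
  then show ?thesis using b(2) basisE unfolding has_degree_def n_def
    by (intro exI[of _ "card J"]) (auto simp: card_cartesian_product)
qed

lemma has_degree_if_basis_over:
  assumes "basis_over K bs"
  shows "has_degree K (length bs)"
proof -
  have "field_basis K {..<length bs} (\<lambda>i. bs ! i)"
    using assms unfolding basis_over_def field_basis_def Ball_def lessThan_iff
    by (intro conjI finite_lessThan) (erule conjunct1, erule conjunct2)
  then show ?thesis unfolding has_degree_def using card_lessThan by (intro exI conjI)
qed

text \<open>The step used in all inductions on the degree: an odd product has odd factors, and
  \<open>l\<close> outside \<open>K\<close> excludes \<open>degree p = 1\<close>, so the remaining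
  degree strictly drops.\<close>

lemma odd_degree_tower:
  assumes K: "is_subfield K" and N: "has_degree K N" "odd N" and l: "l \<notin> K" and p: "is_min_poly K l p"
  shows "odd (degree p)" "\<exists>M. has_degree (adjoin K l) M \<and> odd M \<and> M < N"
proof -
  obtain M where M: "has_degree (adjoin K l) M" "N = degree p * M"
    using degree_tower[OF K N(1) p] by blast
  then show "odd (degree p)" using N(2) by auto
  have "degree p \<noteq> 1"
  proof
    assume 1: "degree p = 1"
    have "poly p l = coeff p 0 + l" using 1 min_polyD(4)[OF p] by (simp add: poly_altdef)
    then have "l = - coeff p 0" using min_polyD(3)[OF p] by (simp add: eq_neg_iff_add_eq_0 add.commute)
    then show False using l min_polyD(1)[OF p] subfield_closed(6)[OF K] by (auto simp: poly_over_def)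
  qed
  then have "degree p > 1" using min_polyD(5)[OF p] by simp
  moreover have "odd M" using M(2) N(2) by simp
  then have "M > 0" by (cases M) auto
  ultimately have "M < N" unfolding M(2) by simp
  then show "\<exists>M. has_degree (adjoin K l) M \<and> odd M \<and> M < N" using M(1) \<open>odd M\<close> by blast
qed

section \<open>Springer's theorem\<close>

definition poly_form :: "'a::field ^ 'n ^ 'n \<Rightarrow> 'a poly ^ 'n \<Rightarrow> 'a poly" where
  "poly_form A = qf (\<chi> i j. [:A $ i $ j:])"

definition poly_space :: "'a::field set \<Rightarrow> 'n set \<Rightarrow> ('a poly ^ 'n) set" where
  "poly_space K I = {x. \<forall>i. x $ i \<in> poly_over K \<and> (i \<notin> I \<longrightarrow> x $ i = 0)}"

lemma poly_poly_form: "poly (poly_form A x) t = qf A (\<chi> i. poly (x $ i) t)"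
  by (simp add: poly_form_def qf_def poly_sum mult.assoc)

lemma poly_form_over:
  assumes K: "is_subfield K" and "mat_in K A" "x \<in> poly_space K I"
  shows "poly_form A x \<in> poly_over K"
  unfolding poly_form_def qf_def using assms(2,3)
  by (intro poly_over_sum[OF K] poly_over_closed(7)[OF K]) (auto simp: poly_space_def mat_in_def intro!: poly_over_closed[OF K])

lemma poly_form_scale: "poly_form A (\<chi> i. e * x $ i) = e ^ 2 * poly_form A x"
  by (simp add: poly_form_def qf_def sum_distrib_left power2_eq_square mult_ac)

text \<open>Vectors congruent modulo \<open>g\<close> have congruent values: \<open>h\<close>
  collects the mixed terms and the multiple of q(y) that carries a second factor
  \<open>g\<close>.\<close>

lemma poly_form_shift:
  assumes K: "is_subfield K" and A: "mat_in K A" and x: "x \<in> poly_space K I" and y: "y \<in> poly_space K I"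
    and g: "g \<in> poly_over K"
  shows "\<exists>h\<in>poly_over K. poly_form A (\<chi> i. x $ i + g * y $ i) = poly_form A x + h * g"
proof -
  define h where "h = (\<Sum>i\<in>UNIV. \<Sum>j\<in>UNIV. [:A $ i $ j:] * (x $ i * y $ j + y $ i * x $ j + g * (y $ i * y $ j)))"
  have "h \<in> poly_over K"
    unfolding h_def using A x y g
    by (intro poly_over_sum[OF K] poly_over_closed(7)[OF K] poly_over_closed(5)[OF K])
      (auto simp: poly_space_def mat_in_def intro!: poly_over_closed[OF K])
  moreover have "poly_form A (\<chi> i. x $ i + g * y $ i) = poly_form A x + h * g"
  proof -
    have "poly_form A (\<chi> i. x $ i + g * y $ i) = (\<Sum>i\<in>UNIV. \<Sum>j\<in>UNIV. [:A $ i $ j:] * x $ i * x $ j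
        + [:A $ i $ j:] * (x $ i * y $ j + y $ i * x $ j + g * (y $ i * y $ j)) * g)"
      unfolding poly_form_def qf_def by (intro sum.cong refl) (simp add: algebra_simps smult_add_right)
    also have "\<dots> = poly_form A x + h * g"
      unfolding poly_form_def qf_def h_def by (simp add: sum.distrib sum_distrib_right)
    finally show ?thesis .
  qed
  ultimately show ?thesis by blast
qed

lemma coeff_mult_top:
  assumes "degree f \<le> m" "degree g \<le> n"
  shows "coeff (f * g) (m + n) = coeff f m * coeff g n"
proof -
  have "coeff (f * g) (m + n) = (\<Sum>i\<le>m + n. coeff f i * coeff g (m + n - i))"
    by (rule coeff_mult)
  also have "\<dots> = (\<Sum>i\<in>{m}. coeff f i * coeff g (m + n - i))"
  proof (rule sum.mono_neutral_right)
    show "\<forall>i\<in>{..m + n} - {m}. coeff f i * coeff g (m + n - i) = 0"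
    proof
      fix i assume "i \<in> {..m + n} - {m}"
      then have "i > m \<or> m + n - i > n" by auto
      then show "coeff f i * coeff g (m + n - i) = 0"
        using assms by (auto simp: coeff_eq_0)
    qed
  qed auto
  finally show ?thesis by simp
qed

lemma poly_form_top:
  assumes "\<And>i. degree (x $ i) \<le> k"
  shows "degree (poly_form A x) \<le> 2 * k"
    "coeff (poly_form A x) (2 * k) = qf A (\<chi> i. coeff (x $ i) k)"
proof -
  have d: "degree (x $ i * x $ j) \<le> k + k" for i j
    using degree_mult_le[of "x $ i" "x $ j"] assms[of i] assms[of j] by linarith
  show "degree (poly_form A x) \<le> 2 * k"
    unfolding poly_form_def qf_def
    by (intro degree_sum_le) (auto simp: mult_2 mult.assoc intro!: degree_smult_le[THEN order_trans] d)
  show "coeff (poly_form A x) (2 * k) = qf A (\<chi> i. coeff (x $ i) k)"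
    unfolding poly_form_def qf_def
    by (simp add: coeff_sum mult_2 coeff_mult_top[OF assms assms] mult.assoc)
qed

lemma poly_vector_degree:
  fixes x :: "'a::field poly ^ 'n::finite"
  assumes "x \<noteq> 0"
  obtains k i where "\<And>i. degree (x $ i) \<le> k" "coeff (x $ i) k \<noteq> 0" "degree (x $ i) = k"
proof -
  obtain j where j: "x $ j \<noteq> 0" using assms by (auto simp: vec_eq_iff)
  define P where "P i \<longleftrightarrow> x $ i \<noteq> 0" for i
  define k where "k = Max ((\<lambda>i. degree (x $ i)) ` {i. P i})"
  have "k \<in> (\<lambda>i. degree (x $ i)) ` {i. P i}"
    unfolding k_def using j by (intro Max_in) (auto simp: P_def)
  then obtain i where i: "x $ i \<noteq> 0" "degree (x $ i) = k" by (auto simp: P_def)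
  have "degree (x $ i) \<le> k" for i
  proof (cases "x $ i = 0")
    case False
    then show ?thesis unfolding k_def by (intro Max_ge) (auto simp: P_def)
  qed simp
  then show thesis using that i by (metis leading_coeff_0_iff)
qed

text \<open>The coefficient of degree \<open>2 * k\<close> is the form evaluated at the nonzero
  vector of coefficients of degree \<open>k\<close>, so anisotropy prevents cancellation. That
  values have even degree is the parity on which both descents rest.\<close>

lemma poly_form_degree:
  fixes A :: "'a::field ^ 'n::finite ^ 'n"
  assumes an: "anisotropic K I (qf A)" and x: "x \<in> poly_space K I"
    and k: "\<And>i. degree (x $ i) \<le> k" "coeff (x $ i) k \<noteq> 0"
  shows "poly_form A x \<noteq> 0" "degree (poly_form A x) = 2 * k"
proof -
  have "(\<chi> i. coeff (x $ i) k) \<in> coord_space K I"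
    using x by (auto simp: poly_space_def poly_over_def coord_space_def)
  moreover have "(\<chi> i. coeff (x $ i) k) \<noteq> 0" using k(2) by (auto simp: vec_eq_iff)
  ultimately have c: "coeff (poly_form A x) (2 * k) \<noteq> 0"
    using an poly_form_top(2)[OF k(1)] by (auto simp: anisotropic_def)
  then show "poly_form A x \<noteq> 0" by auto
  show "degree (poly_form A x) = 2 * k"
    using c poly_form_top(1)[OF k(1)] le_degree by (metis antisym)
qed

text \<open>Springer's descent, phrased for an arbitrary odd-degree polynomial so that no factorisation
  is needed: a primitive zero of the form modulo g yields one modulo a cofactor of smaller odd degree.\<close>

lemma odd_degree_no_primitive_zero:
  fixes A :: "'a::field ^ 'n::finite ^ 'n"
  assumes K: "is_subfield K" and A: "mat_in K A" and an: "anisotropic K I (qf A)"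
    and "g \<in> poly_over K" "odd (degree g)" "x \<in> poly_space K I"
    and "\<And>d b. d \<in> poly_over K \<Longrightarrow> b \<in> poly_over K \<Longrightarrow> g = b * d \<Longrightarrow>
      \<forall>i. \<exists>a\<in>poly_over K. x $ i = a * d \<Longrightarrow> degree d = 0"
    and "h \<in> poly_over K" "poly_form A x = h * g"
  shows False
  using assms(4-)
proof (induction "degree g" arbitrary: g x h rule: less_induct)
  case less
  note g = less.prems(1) and odd = less.prems(2) and x = less.prems(3) and prim = less.prems(4)
  have g0: "g \<noteq> 0" using odd by auto
  \<comment> \<open>Reduce all coordinates modulo \<open>g\<close>. Coordinates outside
    \<open>I\<close> are kept at zero so that the remainder vector stays in the same space.\<close>
  have "\<forall>i. \<exists>a r. a \<in> poly_over K \<and> r \<in> poly_over K \<and> (i \<notin> I \<longrightarrow> a = 0 \<and> r = 0) \<and>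
      x $ i = a * g + r \<and> (r = 0 \<or> degree r < degree g)"
  proof
    fix i
    show "\<exists>a r. a \<in> poly_over K \<and> r \<in> poly_over K \<and> (i \<notin> I \<longrightarrow> a = 0 \<and> r = 0) \<and>
      x $ i = a * g + r \<and> (r = 0 \<or> degree r < degree g)"
    proof (cases "i \<in> I")
      case True
      have "x $ i \<in> poly_over K" using x by (auto simp: poly_space_def)
      from poly_over_division[OF K g g0 this] show ?thesis using True by blast
    next
      case False
      then show ?thesis using x poly_over_closed(1)[OF K]
        by (intro exI[of _ 0]) (auto simp: poly_space_def)
    qed
  qed
  then obtain a r' where ar: "\<And>i. a i \<in> poly_over K" "\<And>i. r' i \<in> poly_over K"
      "\<And>i. i \<notin> I \<Longrightarrow> a i = 0 \<and> r' i = 0" "\<And>i. x $ i = a i * g + r' i"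
      "\<And>i. r' i = 0 \<or> degree (r' i) < degree g"
    by metis
  define r where "r = (\<chi> i. r' i)"
  have r: "r \<in> poly_space K I" "(\<chi> i. - a i) \<in> poly_space K I"
    using ar(1,2,3) poly_over_closed(6)[OF K poly_over_closed(1)[OF K]]
    by (auto simp: r_def poly_space_def)
  have "r = (\<chi> i. x $ i + g * (\<chi> i. - a i) $ i)"
    using ar(4) by (simp add: r_def vec_eq_iff)
  with poly_form_shift[OF K A x r(2) g] less.prems(5,6)
  obtain h' where h': "h' \<in> poly_over K" "poly_form A r = h' * g"
    using poly_over_closed(5)[OF K] by (metis distrib_right)
  have prim_r: "degree d = 0" if d: "d \<in> poly_over K" "b \<in> poly_over K" "g = b * d"
      "\<forall>i. \<exists>c\<in>poly_over K. r $ i = c * d" for d b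
  proof (rule prim[OF d(1-3)], rule allI)
    fix i
    obtain c where c: "c \<in> poly_over K" "r $ i = c * d" using d(4) by blast
    have "x $ i = (a i * b + c) * d"
      using ar(4)[of i] c(2) d(3) by (simp add: r_def algebra_simps)
    moreover have "a i * b + c \<in> poly_over K" by (intro poly_over_closed[OF K] ar c d)
    ultimately show "\<exists>c\<in>poly_over K. x $ i = c * d" by blast
  qed
  have "r \<noteq> 0"
  proof
    assume "r = 0"
    then have "degree g = 0"
      using prim_r[of g 1] g poly_over_closed(1,2)[OF K] by force
    then show False using odd by simp
  qed
  then obtain i0 where i0: "r $ i0 \<noteq> 0" by (auto simp: vec_eq_iff)
  \<comment> \<open>\<open>D\<close> describes the common divisors of the coordinates of
    \<open>r\<close>; one of largest degree acts as their gcd, and dividing it out leaves the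
    primitive vector \<open>y\<close>.\<close>
  define D where "D d \<longleftrightarrow> d \<in> poly_over K \<and> (\<forall>i. \<exists>c\<in>poly_over K. r $ i = c * d)" for d
  have "D 1"
    using r(1) poly_over_closed(2)[OF K] by (auto simp: D_def poly_space_def)
  moreover have "\<forall>d. D d \<longrightarrow> degree d \<le> degree (r $ i0)"
  proof (intro allI impI)
    fix d assume "D d"
    then obtain c where "r $ i0 = c * d" by (auto simp: D_def)
    then show "degree d \<le> degree (r $ i0)" using i0 by (auto simp: degree_mult_eq)
  qed
  then have "\<forall>d. D d \<longrightarrow> degree d < Suc (degree (r $ i0))" by auto
  ultimately obtain e where e: "D e" "\<And>d. D d \<Longrightarrow> degree d \<le> degree e"
    using ex_has_greatest_nat[of D 1 degree] by blast
  have eK: "e \<in> poly_over K" using e(1) by (simp add: D_def)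
  have e0: "e \<noteq> 0" using e(1) i0 by (auto simp: D_def)
  have "\<forall>i. \<exists>c. c \<in> poly_over K \<and> r $ i = c * e" using e(1) by (auto simp: D_def)
  then obtain y' where y': "\<And>i. y' i \<in> poly_over K" "\<And>i. r $ i = y' i * e" by metis
  define y where "y = (\<chi> i. y' i)"
  have y: "y \<in> poly_space K I"
    using y' r(1) e0 by (auto simp: y_def poly_space_def)
  have ry: "r = (\<chi> i. e * y $ i)" using y'(2) by (simp add: y_def vec_eq_iff mult.commute)
  have prim_y: "degree d = 0" if d: "d \<in> poly_over K" "\<forall>i. \<exists>c\<in>poly_over K. y $ i = c * d" for d
  proof -
    have "D (d * e)"
      unfolding D_def
    proof (intro conjI allI)
      show "d * e \<in> poly_over K" by (intro poly_over_closed[OF K] d eK)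
      fix i
      obtain c where "c \<in> poly_over K" "y $ i = c * d" using d(2) by blast
      then show "\<exists>c\<in>poly_over K. r $ i = c * (d * e)"
        unfolding ry by (intro bexI[of _ c]) auto
    qed
    moreover have "d \<noteq> 0"
    proof
      assume "d = 0"
      then have "y $ i0 = 0" using d(2) by auto
      then show False using i0 unfolding ry by simp
    qed
    ultimately show ?thesis using e(2)[of "d * e"] e0 by (simp add: degree_mult_eq)
  qed
  \<comment> \<open>A common divisor of \<open>e\<close> and \<open>g\<close> divides
    \<open>g\<close> and all coordinates of \<open>r\<close>, hence is constant. So
    \<open>e ^ 2\<close> can be cancelled modulo \<open>g\<close>, and \<open>g\<close> divides the
    value \<open>Q\<close> at \<open>y\<close>.\<close>
  have "\<exists>u\<in>poly_over K. \<exists>v\<in>poly_over K. u * e + v * g = 1"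
  proof (rule poly_over_bezout[OF K eK g g0])
    fix d c b assume d: "d \<in> poly_over K" "c \<in> poly_over K" "b \<in> poly_over K" "e = c * d" "g = b * d"
    show "degree d = 0"
    proof (rule prim_r[OF d(1,3,5)], rule allI)
      fix i
      have "r $ i = (y' i * c) * d" using y'(2)[of i] d(4) by simp
      then show "\<exists>c\<in>poly_over K. r $ i = c * d" using poly_over_closed(7)[OF K y'(1) d(2)] by blast
    qed
  qed
  then obtain u v where uv: "u \<in> poly_over K" "v \<in> poly_over K" "u * e + v * g = 1" by blast
  define Q where "Q = poly_form A y"
  have Q: "Q \<in> poly_over K" unfolding Q_def by (rule poly_form_over[OF K A y])
  have eQ: "e ^ 2 * Q = h' * g" using h'(2) unfolding ry poly_form_scale Q_def .
  \<comment> \<open>The cofactor of \<open>g\<close> in \<open>Q\<close>, read off from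
    \<open>Q = (u * e + v * g) ^ 2 * Q\<close>.\<close>
  define H where "H = u ^ 2 * h' + (2 * u * e * v + v ^ 2 * g) * Q"
  have two: "2 * u \<in> poly_over K" using poly_over_closed(5)[OF K uv(1) uv(1)] by (simp only: mult_2)
  have H: "H \<in> poly_over K" unfolding H_def power2_eq_square
    by (intro poly_over_closed(5,7)[OF K] two uv h' Q g eK)
  have "Q = (u * e + v * g) ^ 2 * Q" using uv(3) by simp
  also have "\<dots> = u ^ 2 * (e ^ 2 * Q) + (2 * u * e * v + v ^ 2 * g) * Q * g"
    by (simp add: power2_eq_square algebra_simps)
  also have "\<dots> = g * H" unfolding eQ H_def by (simp add: algebra_simps)
  finally have QH: "Q = g * H" .
  have "y \<noteq> 0" using i0 ry by (auto simp: vec_eq_iff)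
  then obtain k j where k: "\<And>i. degree (y $ i) \<le> k" "coeff (y $ j) k \<noteq> 0" "degree (y $ j) = k"
    by (rule poly_vector_degree) blast
  have dQ: "Q \<noteq> 0" "degree Q = 2 * k"
    using poly_form_degree[OF an y k(1,2)] by (auto simp: Q_def)
  have "degree (r $ j) < degree g"
    using ar(5)[of j] y'(2)[of j] k(2) e0 by (auto simp: r_def y_def)
  moreover have "degree (r $ j) = k + degree e"
    unfolding ry using k(2,3) e0 by (auto simp: degree_mult_eq)
  ultimately have kg: "k < degree g" by simp
  \<comment> \<open>An even total with odd \<open>degree g\<close> makes \<open>degree H\<close>
    odd, and \<open>k < degree g\<close> makes it smaller than \<open>degree g\<close>. Thus
    \<open>y\<close> is a primitive zero modulo \<open>H\<close>, with \<open>g\<close> now as the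
    cofactor.\<close>
  have "2 * k = degree g + degree H"
    using dQ QH by (auto simp: degree_mult_eq)
  then have "degree H < degree g" "odd (degree H)" using kg odd by presburger+
  then show False
    using less.hyps[OF _ H _ y _ g, of] prim_y QH unfolding Q_def by blast
qed

text \<open>A nontrivial zero over K(l) lifts to polynomial coordinates of degree below that of
  \<open>p\<close>, at which the form is divisible by \<open>p\<close>. The lift is primitive modulo
  \<open>p\<close> because \<open>p\<close> is irreducible and some coordinate is nonzero of smaller
  degree.\<close>

lemma anisotropic_adjoin_odd:
  fixes q :: "'a::field ^ 'n::finite \<Rightarrow> 'a"
  assumes K: "is_subfield K" and q: "form_over K q" and an: "anisotropic K I q"
    and p: "is_min_poly K l p" and odd: "odd (degree p)"
  shows "anisotropic (adjoin K l) I q"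
  unfolding anisotropic_def
proof (intro ballI impI, rule ccontr)
  fix z assume z: "z \<in> coord_space (adjoin K l) I" "q z = 0" "z \<noteq> 0"
  obtain A where A: "mat_in K A" "q = qf A" using q by (auto simp: form_over_def)
  have "\<forall>i. \<exists>f. f \<in> poly_over K \<and> degree f < degree p \<and> poly f l = z $ i"
    using z(1) adjoin_reduced[OF K p] by (auto simp: coord_space_def)
  then obtain f where f: "\<And>i. f i \<in> poly_over K" "\<And>i. degree (f i) < degree p" "\<And>i. poly (f i) l = z $ i"
    by metis
  have f0: "f i = 0 \<longleftrightarrow> z $ i = 0" for i
    using f min_polyD(6)[OF p] by (metis poly_0)
  define x where "x = (\<chi> i. f i)"
  have x: "x \<in> poly_space K I"
    using f(1) f0 z(1) by (auto simp: x_def poly_space_def coord_space_def)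
  have "poly (poly_form A x) l = 0"
    using z(2) f(3) unfolding poly_poly_form A(2) x_def by simp
  then obtain h where h: "h \<in> poly_over K" "poly_form A x = h * p"
    using min_poly_dvd[OF K p poly_form_over[OF K A(1) x]] by blast
  obtain i where i: "f i \<noteq> 0" using z(3) f0 by (auto simp: vec_eq_iff)
  show False
  proof (rule odd_degree_no_primitive_zero[OF K A(1) _ min_polyD(1)[OF p] odd x _ h])
    show "anisotropic K I (qf A)" using an A by simp
    fix d b assume d: "d \<in> poly_over K" "b \<in> poly_over K" "p = b * d" "\<forall>i. \<exists>a\<in>poly_over K. x $ i = a * d"
    obtain c where "f i = c * d" using d(4) by (auto simp: x_def)
    then have "degree d \<le> degree (f i)" using i by (auto simp: degree_mult_eq)
    moreover have "degree p = degree b + degree d"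
      using d(3) min_polyD(2)[OF p] by (auto simp: degree_mult_eq)
    ultimately show "degree d = 0"
      using min_poly_irreducible[OF p d(2,1,3)] f(2)[of i] by auto
  qed
qed

text \<open>Climb from \<open>K\<close> to the whole field by simple extensions: any
  \<open>l\<close> outside the current subfield gives a step of odd degree and leaves a smaller odd
  degree above it.\<close>

theorem springer:
  fixes q :: "'a::field ^ 'n::finite \<Rightarrow> 'a"
  assumes "is_subfield K" "has_degree K N" "odd N" "form_over K q" "anisotropic K I q"
  shows "anisotropic UNIV I q"
  using assms
proof (induction N arbitrary: K rule: less_induct)
  case (less N)
  note K = less.prems(1)
  show ?case
  proof (cases "K = UNIV")
    case True
    then show ?thesis using less.prems by simp
  next
    case False
    then obtain l where l: "l \<notin> K" by auto
    obtain p where p: "is_min_poly K l p" using min_poly_exists[OF K less.prems(2)] by blast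
    obtain M where M: "odd (degree p)" "has_degree (adjoin K l) M" "odd M" "M < N"
      using odd_degree_tower[OF K less.prems(2,3) l p] by blast
    show ?thesis
      using less.IH[OF M(4) adjoin_subfield[OF K p] M(2,3)]
        anisotropic_adjoin_odd[OF K less.prems(4,5) p M(1)]
        form_over_mono[OF less.prems(4) adjoin_base(1)[OF K]] by blast
  qed
qed

section \<open>Descent of similitudes of anisotropic forms\<close>

lemma anisotropic_mono:
  assumes "anisotropic S' I q" "S \<subseteq> S'"
  shows "anisotropic S I q"
  using assms coord_space_mono[of S S' I I] unfolding anisotropic_def by blast

lemma isometric_on_refl: "isometric_on S I I q q"
  unfolding isometric_on_def by (rule exI[of _ id]) (auto simp: linear_over_def)

text \<open>Dividing an isometry by \<open>a\<close> turns it into a similitude with factor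
  \<open>a ^ 2\<close>; this produces a factor that generates a proper extension.\<close>

lemma isometric_on_square:
  fixes q q' :: "'a::field ^ 'n::finite \<Rightarrow> 'a"
  assumes S: "is_subfield S" and q': "form_over UNIV q'" and a: "a \<in> S" "a \<noteq> 0"
    and "isometric_on S I J q q'" and card: "card I = card J"
  shows "isometric_on S I J q (\<lambda>x. a ^ 2 * q' x)"
proof -
  obtain f g where f: "linear_over S (coord_space S I) f"
    "\<And>x. x \<in> coord_space S I \<Longrightarrow> f x \<in> coord_space S J"
    "\<And>x. x \<in> coord_space S I \<Longrightarrow> g (f x) = x"
    "\<And>x. x \<in> coord_space S I \<Longrightarrow> q' (f x) = q x"
    using isometric_onE[OF S assms(5)] by metis
  have ai: "inverse a \<in> S" using a by (intro subfield_closed[OF S])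
  show ?thesis
  proof (rule isometric_onI[OF S, of _ "\<lambda>x. inverse a *s f x"])
    show "linear_over S (coord_space S I) (\<lambda>x. inverse a *s f x)"
      using f(1) by (auto simp: linear_over_def vec_eq_iff algebra_simps)
    fix x assume x: "x \<in> coord_space S I"
    then show "inverse a *s f x \<in> coord_space S J"
      by (intro coord_space_closed[OF S] ai f)
    show "a ^ 2 * q' (inverse a *s f x) = q x"
      using a f(4)[OF x] by (simp add: form_over_polar(2)[OF q'] field_simps)
    assume "inverse a *s f x = 0"
    then have "f x = 0" using a by (simp add: vec_eq_iff)
    then have "f x = f 0" using linear_over_zero[OF S f(1)] by simp
    then show "x = 0" using f(3)[OF x] f(3)[OF coord_space_closed(1)[OF S]] by simp
  qed (rule card)
qed

text \<open>The relation \<open>R\<close> consists of the polynomial pairs described in the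
  overview. Every x(0) occurs in it and determines its partner, so sending x(0) to the top
  coefficient of \<open>y\<close> is a well-defined linear map over \<open>K\<close>, and comparing
  extreme coefficients gives its factor.\<close>

lemma similitude_descent:
  fixes q q' :: "'a::field ^ 'n::finite \<Rightarrow> 'a"
  assumes K: "is_subfield K" and q: "form_over K q" and q': "form_over K q'"
    and an: "anisotropic K I q" and an': "anisotropic K J q'"
    and p: "is_min_poly K l p" and odd: "odd (degree p)" and l0: "l \<noteq> 0"
    and card: "card I = card J"
    and iso: "isometric_on (adjoin K l) I J q (\<lambda>x. l * q' x)"
  shows "isometric_on K I J q (\<lambda>x. - coeff p 0 * q' x)"
proof -
  let ?E = "adjoin K l"
  have E: "is_subfield ?E" by (rule adjoin_subfield[OF K p])
  have KE: "K \<subseteq> ?E" and lE: "l \<in> ?E" using adjoin_base[OF K] by auto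
  obtain A where A: "mat_in K A" "q = qf A" using q by (auto simp: form_over_def)
  obtain B where B: "mat_in K B" "q' = qf B" using q' by (auto simp: form_over_def)
  obtain m where m: "degree p = 2 * m + 1" using odd by (auto elim: oddE)
  obtain f where f: "linear_over ?E (coord_space ?E I) f"
    "\<And>x. x \<in> coord_space ?E I \<Longrightarrow> f x \<in> coord_space ?E J"
    "\<And>x. x \<in> coord_space ?E I \<Longrightarrow> l * q' (f x) = q x"
    using isometric_onE[OF E iso] by metis
  define ev :: "'a poly ^ 'n \<Rightarrow> 'a ^ 'n" where "ev x = (\<chi> i. poly (x $ i) l)" for x
  define sm :: "'a \<Rightarrow> 'a poly ^ 'n \<Rightarrow> 'a poly ^ 'n" where "sm c x = (\<chi> i. smult c (x $ i))" for c x
  define cf :: "nat \<Rightarrow> 'a poly ^ 'n \<Rightarrow> 'a ^ 'n" where "cf k x = (\<chi> i. coeff (x $ i) k)" for k x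
  have ev_space: "ev x \<in> coord_space ?E L" if "x \<in> poly_space K L" for x L
    using that by (auto simp: ev_def poly_space_def coord_space_def adjoin_def)
  have ev_add: "ev (x + y) = ev x + ev y" and ev_sm: "ev (sm c x) = c *s ev x" for c x y
    by (simp_all add: ev_def sm_def vec_eq_iff)
  have cf_add: "cf k (x + y) = cf k x + cf k y" and cf_sm: "cf k (sm c x) = c *s cf k x" for c x y k
    by (simp_all add: cf_def sm_def vec_eq_iff)
  have cf_space: "cf k x \<in> coord_space K L" if "x \<in> poly_space K L" for k x L
    using that by (auto simp: cf_def poly_space_def poly_over_def coord_space_def)
  \<comment> \<open>\<open>R\<close> is closed under sums and scalars from \<open>K\<close>. The
    bound \<open>m\<close> is half of \<open>degree p - 1\<close>, so multiplying q'(y) by X reaches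
    exactly the degree of \<open>p\<close>.\<close>
  define R where "R x y \<longleftrightarrow> x \<in> poly_space K I \<and> y \<in> poly_space K J \<and> (\<forall>i. degree (x $ i) \<le> m) \<and>
      (\<forall>j. degree (y $ j) \<le> m) \<and> f (ev x) = ev y" for x y
  have R_add: "R (x + x') (y + y')" if "R x y" "R x' y'" for x x' y y'
    using that f(1) ev_space ev_add poly_over_closed(5)[OF K]
    unfolding R_def linear_over_def by (auto simp: poly_space_def intro!: degree_add_le)
  have R_sm: "R (sm c x) (sm c y)" if "c \<in> K" "R x y" for c x y
  proof -
    have "f (c *s ev x) = c *s f (ev x)"
      using f(1) that KE ev_space unfolding R_def linear_over_def by blast
    moreover have "sm c x \<in> poly_space K I" "sm c y \<in> poly_space K J"
      using that poly_over_closed(8)[OF K] by (auto simp: R_def sm_def poly_space_def)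
    moreover have "degree (sm c x $ i) \<le> m" "degree (sm c y $ i) \<le> m" for i
      using that by (auto simp: R_def sm_def intro!: degree_smult_le[THEN order_trans])
    ultimately show ?thesis using that by (simp add: R_def ev_sm)
  qed
  \<comment> \<open>The difference of q(x) and X q'(y) vanishes at \<open>l\<close> and has degree
    at most \<open>2 * m + 1\<close>, so it is a constant times the monic \<open>p\<close>. The
    constant is its coefficient of degree \<open>2 * m + 1\<close>, to which q(x) contributes
    nothing.\<close>
  have key: "poly_form A x = pCons 0 (poly_form B y) + smult (- q' (cf m y)) p" if R: "R x y" for x y
  proof -
    have x: "x \<in> poly_space K I" and y: "y \<in> poly_space K J"
      and dx: "\<And>i. degree (x $ i) \<le> m" and dy: "\<And>i. degree (y $ i) \<le> m" and fe: "f (ev x) = ev y"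
      using R by (auto simp: R_def)
    define P where "P = poly_form A x - pCons 0 (poly_form B y)"
    have "P \<in> poly_over K"
      unfolding P_def using poly_form_over[OF K A(1) x] poly_form_over[OF K B(1) y] subfield_closed(1)[OF K]
      by (intro poly_over_closed[OF K])
    moreover have "poly P l = q (ev x) - l * q' (ev y)"
      by (simp add: P_def poly_poly_form A B ev_def)
    then have "poly P l = 0" using f(3)[OF ev_space[OF x]] fe by simp
    ultimately obtain a where a: "a \<in> poly_over K" "P = a * p" using min_poly_dvd[OF K p] by blast
    have "degree (pCons 0 (poly_form B y)) \<le> degree p"
      using poly_form_top(1)[OF dy, of B] m by (simp add: degree_pCons_le[THEN order_trans])
    then have dP: "degree P \<le> degree p"
      unfolding P_def using poly_form_top(1)[OF dx, of A] m by (intro degree_diff_le) auto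
    have "degree a = 0"
      using dP a(2) min_polyD(2)[OF p] by (cases "a = 0") (auto simp: degree_mult_eq)
    then obtain c where c: "a = [:c:]" by (metis degree_eq_zeroE)
    have "c = coeff P (degree p)" using a(2) c min_polyD(4)[OF p] by simp
    also have "\<dots> = - q' (cf m y)"
      unfolding P_def using poly_form_top(1)[OF dx, of A] poly_form_top(2)[OF dy, of B] m
      by (simp add: coeff_eq_0 B(2) cf_def)
    finally have "P = smult (- q' (cf m y)) p" using a(2) c by simp
    then show ?thesis unfolding P_def by (simp add: algebra_simps)
  qed
  have key0: "q (cf 0 x) = - coeff p 0 * q' (cf m y)" if R: "R x y" for x y
  proof -
    have "q (cf 0 x) = poly (poly_form A x) 0"
      unfolding poly_poly_form A(2) cf_def by (simp add: poly_0_coeff_0)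
    also have "\<dots> = - coeff p 0 * q' (cf m y)"
      unfolding key[OF R] by (simp add: poly_0_coeff_0)
    finally show ?thesis .
  qed
  \<comment> \<open>If x(0) = 0, then \<open>key0\<close> with \<open>coeff p 0\<close> nonzero
    makes the constant vanish and q(x) = X q'(y) remains: even degree against odd degree, unless
    both vectors are zero.\<close>
  have zero: "x = 0 \<and> y = 0" if R: "R x y" and 0: "cf 0 x = 0" for x y
  proof -
    have x: "x \<in> poly_space K I" and y: "y \<in> poly_space K J"
      using R by (auto simp: R_def)
    have "q' (cf m y) = 0"
      using key0[OF R] 0 min_poly_const_nonzero(1)[OF K p l0] form_over_polar(3)[OF q] by simp
    then have eq: "poly_form A x = pCons 0 (poly_form B y)" using key[OF R] by simp
    have "y = 0"
    proof (rule ccontr)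
      assume "y \<noteq> 0"
      then obtain k j where k: "\<And>i. degree (y $ i) \<le> k" "coeff (y $ j) k \<noteq> 0"
        by (rule poly_vector_degree) blast
      have By: "poly_form B y \<noteq> 0" "degree (poly_form B y) = 2 * k"
        using poly_form_degree[OF _ y k] an' B by auto
      then have "degree (poly_form A x) = 2 * k + 1" "poly_form A x \<noteq> 0" unfolding eq by auto
      moreover from this have "x \<noteq> 0" by (auto simp: poly_form_def qf_def)
      then obtain k' j' where k': "\<And>i. degree (x $ i) \<le> k'" "coeff (x $ j') k' \<noteq> 0"
        by (rule poly_vector_degree) blast
      then have "degree (poly_form A x) = 2 * k'"
        using poly_form_degree[OF _ x k'] an A by auto
      ultimately show False by presburger
    qed
    moreover have "x = 0"
    proof (rule ccontr)
      assume "x \<noteq> 0"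
      then obtain k' j' where k': "\<And>i. degree (x $ i) \<le> k'" "coeff (x $ j') k' \<noteq> 0"
        by (rule poly_vector_degree) blast
      then have "poly_form A x \<noteq> 0"
        using poly_form_degree[OF _ x k'] an A by auto
      then show False using eq \<open>y = 0\<close> by (simp add: poly_form_def qf_def)
    qed
    ultimately show ?thesis by simp
  qed
  have "\<forall>e\<in>?E. \<exists>h. h \<in> poly_over K \<and> degree h < degree p \<and> poly h l = e"
    using adjoin_reduced[OF K p] by blast
  then obtain rep where rep: "\<And>e. e \<in> ?E \<Longrightarrow> rep e \<in> poly_over K"
      "\<And>e. e \<in> ?E \<Longrightarrow> degree (rep e) < degree p" "\<And>e. e \<in> ?E \<Longrightarrow> poly (rep e) l = e"
    by metis
  have rep0: "rep 0 = 0"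
    using rep[of 0] min_polyD(6)[OF p] subfield_closed(1)[OF E] by blast
  \<comment> \<open>The dimension count: one scalar in front of \<open>v\<close> and
    \<open>m\<close> higher coefficients in each coordinate of \<open>x\<close>, against the
    \<open>m\<close> coefficients from \<open>m + 1\<close> to \<open>2 * m\<close> that must vanish
    in each coordinate of \<open>y\<close>.\<close>
  have ex: "\<exists>x y. R x y \<and> cf 0 x = v" if v: "v \<in> coord_space K I" for v
  proof -
    define U where "U = insert None (Some ` (I \<times> {1..m}))"
    \<comment> \<open>The values at \<open>l\<close> of the free directions: the constant vector
      \<open>v\<close>, and X to the power \<open>t\<close> in coordinate \<open>i\<close>.\<close>
    define w where "w u = (case u of None \<Rightarrow> v | Some (i, t) \<Rightarrow> l ^ t *s axis i 1)" for u
    define c where "c jk u = coeff (rep (f (w u) $ fst jk)) (snd jk)" for jk :: "'n \<times> nat" and u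
    have wE: "w u \<in> coord_space ?E I" if "u \<in> U" for u
      using that v coord_space_mono[OF KE order_refl, of I] lE unfolding U_def w_def
      by (auto intro!: coord_space_closed[OF E] subfield_closed[OF E])
    have fwE: "f (w u) $ j \<in> ?E" if "u \<in> U" for u j
      using f(2)[OF wE[OF that]] by (simp add: coord_space_def)
    have "\<exists>s. (\<forall>u\<in>U. s u \<in> K) \<and> (\<exists>u\<in>U. s u \<noteq> 0) \<and>
        (\<forall>jk\<in>J \<times> {m+1..2*m}. (\<Sum>u\<in>U. c jk u * s u) = 0)"
    proof (rule homogeneous_system_solution[OF K])
      have "card U = Suc (card I * m)"
        unfolding U_def by (subst card_insert_disjoint) (auto simp: card_image card_cartesian_product)
      then show "card (J \<times> {m+1..2*m}) < card U" using card by (simp add: card_cartesian_product)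
      show "c jk u \<in> K" if "jk \<in> J \<times> {m+1..2*m}" "u \<in> U" for jk u
        using rep(1)[OF fwE[OF that(2)]] by (simp add: c_def poly_over_def)
    qed (auto simp: U_def)
    then obtain s where s: "\<forall>u\<in>U. s u \<in> K" "\<exists>u\<in>U. s u \<noteq> 0"
        "\<forall>jk\<in>J \<times> {m+1..2*m}. (\<Sum>u\<in>U. c jk u * s u) = 0" by blast
    define x where "x = (\<chi> i. if i \<in> I then [:s None * v $ i:] + (\<Sum>t=1..m. monom (s (Some (i, t))) t) else 0)"
    define y where "y = (\<chi> j. \<Sum>u\<in>U. smult (s u) (rep (f (w u) $ j)))"
    have sN: "s None \<in> K" and sS: "\<And>i t. i \<in> I \<Longrightarrow> t \<in> {1..m} \<Longrightarrow> s (Some (i, t)) \<in> K"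
      using s(1) by (auto simp: U_def)
    have cx: "coeff (x $ i) t = (if i \<in> I then if t = 0 then s None * v $ i else
        if t \<le> m then s (Some (i, t)) else 0 else 0)" for i t
    proof -
      have "coeff (\<Sum>t=1..m. monom (s (Some (i, t))) t) t = (if 1 \<le> t \<and> t \<le> m then s (Some (i, t)) else 0)"
        unfolding coeff_sum coeff_monom by (simp add: if_distrib sum.If_cases cong: if_cong)
      then show ?thesis by (auto simp: x_def coeff_pCons split: nat.splits)
    qed
    have "coeff (x $ i) t \<in> K" for i t
      using sN sS v subfield_closed(1,5)[OF K] by (auto simp: cx coord_space_def)
    moreover have "x $ i = 0" if "i \<notin> I" for i using that by (simp add: x_def)
    ultimately have x: "x \<in> poly_space K I" by (simp add: poly_space_def poly_over_def)
    have evx: "ev x = (\<Sum>u\<in>U. s u *s w u)"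
    proof -
      have "ev x $ i = (\<Sum>u\<in>U. s u *s w u) $ i" for i
      proof -
        have "(\<Sum>u\<in>U. s u *s w u) $ i = s None * v $ i + (\<Sum>it\<in>I \<times> {1..m}. (s (Some it) *s w (Some it)) $ i)"
          unfolding U_def by (subst sum.insert) (auto simp: sum.reindex w_def)
        also have "(\<Sum>it\<in>I \<times> {1..m}. (s (Some it) *s w (Some it)) $ i) =
            (\<Sum>(k, t)\<in>I \<times> {1..m}. if k = i then s (Some (k, t)) * l ^ t else 0)"
          by (intro sum.cong) (auto simp: w_def axis_def)
        also have "\<dots> = (\<Sum>k\<in>I. \<Sum>t=1..m. if k = i then s (Some (k, t)) * l ^ t else 0)"
          by (simp add: sum.cartesian_product)
        also have "\<dots> = (\<Sum>k\<in>I. if k = i then (\<Sum>t=1..m. s (Some (k, t)) * l ^ t) else 0)"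
          by (intro sum.cong) auto
        also have "\<dots> = (if i \<in> I then (\<Sum>t=1..m. s (Some (i, t)) * l ^ t) else 0)"
          by simp
        finally show ?thesis
          using v by (auto simp: ev_def x_def poly_sum poly_monom coord_space_def)
      qed
      then show ?thesis by (simp add: vec_eq_iff)
    qed
    have "f (ev x) = (\<Sum>u\<in>U. s u *s f (w u))"
      unfolding evx using s(1) KE by (intro linear_over_sum[OF E f(1)]) (auto intro: wE)
    then have fe: "f (ev x) = ev y"
      using fwE by (simp add: ev_def y_def vec_eq_iff poly_sum rep)
    have y: "y \<in> poly_space K J"
      unfolding poly_space_def
    proof (intro CollectI allI conjI impI)
      fix j
      show "y $ j \<in> poly_over K"
        using s(1) rep(1)[OF fwE] by (auto simp: y_def intro!: poly_over_sum[OF K] poly_over_closed[OF K])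
      assume "j \<notin> J"
      then have "f (w u) $ j = 0" if "u \<in> U" for u
        using f(2)[OF wE[OF that]] by (simp add: coord_space_def)
      then show "y $ j = 0" by (simp add: y_def rep0)
    qed
    have dy: "degree (y $ j) \<le> m" for j
    proof (rule degree_le, intro allI impI)
      fix k assume k: "m < k"
      show "coeff (y $ j) k = 0"
      proof (cases "j \<in> J \<and> k \<le> 2 * m")
        case True
        have "coeff (y $ j) k = (\<Sum>u\<in>U. c (j, k) u * s u)"
          by (simp add: y_def coeff_sum c_def mult.commute)
        then show ?thesis using s(3) True k by auto
      next
        case False
        show ?thesis
        proof (cases "j \<in> J")
          case True
          then have "coeff (rep (f (w u) $ j)) k = 0" if "u \<in> U" for u
            using rep(2)[OF fwE[OF that, of j]] m False by (intro coeff_eq_0) auto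
          then show ?thesis by (simp add: y_def coeff_sum)
        next
          case False
          then show ?thesis using y by (simp add: poly_space_def)
        qed
      qed
    qed
    have dx: "degree (x $ i) \<le> m" for i
      by (rule degree_le) (auto simp: cx)
    have R: "R x y" using x y dx dy fe by (simp add: R_def)
    have c0: "cf 0 x = s None *s v"
      using v by (auto simp: cf_def cx vec_eq_iff coord_space_def)
    \<comment> \<open>Otherwise x(0) = 0, and \<open>zero\<close> would kill \<open>x\<close> and
      with it every unknown of the nontrivial solution. Dividing by \<open>s None\<close> then makes
      the constant term exactly \<open>v\<close>.\<close>
    have "s None \<noteq> 0"
    proof
      assume sN0: "s None = 0"
      then have "x = 0" using zero[OF R] c0 by simp
      have "s (Some (i, t)) = 0" if "i \<in> I" "t \<in> {1..m}" for i t
        using cx[of i t] that \<open>x = 0\<close> by simp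
      then show False using s(2) sN0 by (auto simp: U_def)
    qed
    then have "R (sm (inverse (s None)) x) (sm (inverse (s None)) y)" "cf 0 (sm (inverse (s None)) x) = v"
      using R_sm[OF _ R] subfield_closed(7)[OF K sN] c0 cf_sm by (auto simp: vec_eq_iff)
    then show ?thesis by blast
  qed
  then obtain X Y where XY: "\<And>v. v \<in> coord_space K I \<Longrightarrow> R (X v) (Y v)"
      "\<And>v. v \<in> coord_space K I \<Longrightarrow> cf 0 (X v) = v" by metis
  \<comment> \<open>Differences of pairs in \<open>R\<close> stay in \<open>R\<close>, so
    \<open>zero\<close> makes the chosen \<open>Y v\<close> canonical; linearity of the final map
    follows from this.\<close>
  have uniq: "y = y'" if "R x y" "R x' y'" "cf 0 x = cf 0 x'" for x x' y y'
  proof -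
    have "-1 \<in> K" by (intro subfield_closed[OF K])
    then have "R (x + sm (-1) x') (y + sm (-1) y')" by (intro R_add R_sm that)
    moreover have "cf 0 (x + sm (-1) x') = 0" by (simp add: cf_add cf_sm that(3))
    ultimately have "y + sm (-1) y' = 0" using zero by blast
    then show ?thesis by (simp add: sm_def vec_eq_iff)
  qed
  show ?thesis
  proof (rule isometric_onI[OF K, of _ "\<lambda>v. cf m (Y v)"])
    show "linear_over K (coord_space K I) (\<lambda>v. cf m (Y v))"
      unfolding linear_over_def
    proof (intro conjI ballI)
      fix v w assume vw: "v \<in> coord_space K I" "w \<in> coord_space K I"
      have vw': "v + w \<in> coord_space K I" by (intro coord_space_closed[OF K] vw)
      have "Y (v + w) = Y v + Y w"
        by (rule uniq[OF XY(1)[OF vw'] R_add[OF XY(1)[OF vw(1)] XY(1)[OF vw(2)]]])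
          (simp add: XY(2) vw vw' cf_add)
      then show "cf m (Y (v + w)) = cf m (Y v) + cf m (Y w)" by (simp add: cf_add)
    next
      fix c v assume cv: "c \<in> K" "v \<in> coord_space K I"
      have cv': "c *s v \<in> coord_space K I" by (intro coord_space_closed[OF K] cv)
      have "Y (c *s v) = sm c (Y v)"
        by (rule uniq[OF XY(1)[OF cv'] R_sm[OF cv(1) XY(1)[OF cv(2)]]])
          (simp add: XY(2) cv cv' cf_sm)
      then show "cf m (Y (c *s v)) = c *s cf m (Y v)" by (simp add: cf_sm)
    qed
    fix v assume v: "v \<in> coord_space K I"
    show "cf m (Y v) \<in> coord_space K J"
      using XY(1)[OF v] cf_space by (auto simp: R_def)
    show iso: "- coeff p 0 * q' (cf m (Y v)) = q v"
      using key0[OF XY(1)[OF v]] XY(2)[OF v] by simp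
    assume "cf m (Y v) = 0"
    then have "q v = 0" using iso form_over_polar(3)[OF q'] by simp
    then show "v = 0" using an v by (simp add: anisotropic_def)
  qed (rule card)
qed

section \<open>Descending isometries of anisotropic forms\<close>

lemma sum_even_odd: "(\<Sum>k\<le>2 * m + 1. h k) = (\<Sum>i\<le>m. h (2 * i) + h (2 * i + 1))" for h :: "nat \<Rightarrow> 'a::comm_monoid_add"
  by (induction m) (simp_all add: ac_simps)

text \<open>Splitting \<open>p\<close> into even and odd parts gives P(l^2) + l Q(l^2) = 0, which
  can be solved for \<open>l\<close> because Q(l^2) is not zero.\<close>

lemma odd_min_poly_mem_adjoin_square:
  assumes K: "is_subfield K" and p: "is_min_poly K l p" and odd: "odd (degree p)"
    and E: "is_subfield (adjoin K (l ^ 2))"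
  shows "l \<in> adjoin K (l ^ 2)"
proof -
  obtain m where m: "degree p = 2 * m + 1" using odd by (auto elim: oddE)
  define P where "P = (\<Sum>i\<le>m. monom (coeff p (2 * i)) i)"
  define Q where "Q = (\<Sum>i\<le>m. monom (coeff p (2 * i + 1)) i)"
  \<comment> \<open>\<open>Q'\<close> is Q(X^2). Odd \<open>degree p\<close> puts the leading
    coefficient of \<open>p\<close> into it, so it is nonzero of degree below that of
    \<open>p\<close> and cannot vanish at \<open>l\<close>.\<close>
  define Q' where "Q' = (\<Sum>i\<le>m. monom (coeff p (2 * i + 1)) (2 * i))"
  have cK: "coeff p i \<in> K" for i using min_polyD(1)[OF p] by (simp add: poly_over_def)
  have in_K: "P \<in> poly_over K" "Q \<in> poly_over K" "Q' \<in> poly_over K"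
    unfolding P_def Q_def Q'_def by (intro poly_over_sum[OF K] poly_over_closed[OF K] cK)+
  have QQ': "poly Q (l ^ 2) = poly Q' l"
    by (simp add: Q_def Q'_def poly_sum poly_monom power_mult)
  have "0 = (\<Sum>k\<le>2 * m + 1. coeff p k * l ^ k)"
    using min_polyD(3)[OF p] m by (simp add: poly_altdef)
  also have "\<dots> = poly P (l ^ 2) + l * poly Q (l ^ 2)"
    unfolding sum_even_odd P_def Q_def
    by (simp add: poly_sum poly_monom sum.distrib sum_distrib_left mult_ac flip: power_mult)
  finally have eq: "l * poly Q (l ^ 2) = - poly P (l ^ 2)"
    by (simp add: eq_neg_iff_add_eq_0 add.commute)
  have "coeff Q' (2 * m) = 1"
  proof -
    have "coeff Q' (2 * m) = (\<Sum>i\<le>m. if i = m then coeff p (2 * i + 1) else 0)"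
      by (simp add: Q'_def coeff_sum coeff_monom)
    also have "\<dots> = 1" using min_polyD(4)[OF p] m by simp
    finally show ?thesis .
  qed
  then have "Q' \<noteq> 0" by auto
  moreover have "degree Q' \<le> 2 * m"
    unfolding Q'_def by (intro degree_sum_le) (auto intro: degree_monom_le[THEN order_trans])
  ultimately have "poly Q' l \<noteq> 0"
    using min_polyD(6)[OF p in_K(3)] m by auto
  then have "l = - poly P (l ^ 2) / poly Q (l ^ 2)" using eq QQ' by (simp add: field_simps)
  also have "\<dots> \<in> adjoin K (l ^ 2)"
    using in_K(1,2) by (intro subfield_closed[OF E]) (auto simp: adjoin_def)
  finally show ?thesis .
qed

text \<open>Induction brings the isometry down to K(b) for a square \<open>b = a ^ 2\<close> of an
  element outside \<open>K\<close>. Over K(b) it becomes a similitude with factor \<open>b\<close>,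
  to which \<open>similitude_descent\<close> applies.\<close>

lemma anisotropic_iso_descent:
  fixes q q' :: "'a::field ^ 'n::finite \<Rightarrow> 'a"
  assumes "is_subfield K" "has_degree K N" "odd N" "form_over K q" "form_over K q'"
    and an: "anisotropic UNIV I q" and an': "anisotropic UNIV J q'" and card: "card I = card J"
    and iso: "isometric_on UNIV I J q q'"
  shows "isometric_on K I J q q'"
  using assms(1-5)
proof (induction N arbitrary: K rule: less_induct)
  case (less N)
  note K = less.prems(1) and q = less.prems(4) and q' = less.prems(5)
  show ?case
  proof (cases "K = UNIV")
    case True
    then show ?thesis using iso by simp
  next
    case False
    then obtain a where a: "a \<notin> K" by auto
    define b where "b = a ^ 2"
    obtain pa where pa: "is_min_poly K a pa" using min_poly_exists[OF K less.prems(2)] by blast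
    obtain p where p: "is_min_poly K b p" using min_poly_exists[OF K less.prems(2)] by blast
    have E: "is_subfield (adjoin K b)" by (rule adjoin_subfield[OF K p])
    have aE: "a \<in> adjoin K b"
      unfolding b_def using odd_min_poly_mem_adjoin_square[OF K pa]
        odd_degree_tower(1)[OF K less.prems(2,3) a pa] E unfolding b_def by blast
    \<comment> \<open>Were \<open>b\<close> in \<open>K\<close>, all polynomial values at
      \<open>b\<close> would lie in \<open>K\<close>, and among them \<open>a\<close>.\<close>
    have "b \<notin> K"
      using aE a poly_over_eval[OF K] by (auto simp: adjoin_def)
    then obtain M where M: "odd (degree p)" "has_degree (adjoin K b) M" "odd M" "M < N"
      using odd_degree_tower[OF K less.prems(2,3) _ p] by blast
    have KE: "K \<subseteq> adjoin K b" by (rule adjoin_base[OF K])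
    have descended: "isometric_on (adjoin K b) I J q q'"
      using less.IH[OF M(4) E M(2,3)] form_over_mono[OF q KE] form_over_mono[OF q' KE] by blast
    have a0: "a \<noteq> 0" using a subfield_closed(1)[OF K] by auto
    then have b0: "b \<noteq> 0" by (simp add: b_def)
    have q'U: "form_over UNIV q'" using form_over_mono[OF q'] by blast
    have anK: "anisotropic K I q" "anisotropic K J q'"
      using anisotropic_mono[OF an] anisotropic_mono[OF an'] by auto
    \<comment> \<open>The same is done for q' against itself. Both descend to the same factor
      \<open>- coeff p 0\<close>, so q and q' are isometric over \<open>K\<close> to the same scaled
      form.\<close>
    have "isometric_on (adjoin K b) I J q (\<lambda>x. b * q' x)" "isometric_on (adjoin K b) J J q' (\<lambda>x. b * q' x)"
      unfolding b_def using aE a0 descended E unfolding b_def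
      by (intro isometric_on_square q'U isometric_on_refl card refl; simp)+
    then have "isometric_on K I J q (\<lambda>x. - coeff p 0 * q' x)" "isometric_on K J J q' (\<lambda>x. - coeff p 0 * q' x)"
      using similitude_descent[OF K q q' anK p M(1) b0 card]
        similitude_descent[OF K q' q' anK(2,2) p M(1) b0 refl] by auto
    then show ?thesis using isometric_on_trans isometric_on_sym[OF K] by blast
  qed
qed

text \<open>Over K(l) the factor \<open>l\<close> is a scalar, so q and l q' are two forms over K(l)
  whose isometry descends from L; below K(l) the factor itself is descended. The tower law makes
  both degrees odd.\<close>

lemma anisotropic_similitude_descent:
  fixes q q' :: "'a::field ^ 'n::finite \<Rightarrow> 'a"
  assumes K: "is_subfield K" and N: "has_degree K N" "odd N" and q: "form_over K q" and q': "form_over K q'"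
    and an: "anisotropic UNIV I q" and an': "anisotropic UNIV J q'" and card: "card I = card J"
    and p: "is_min_poly K l p" and l0: "l \<noteq> 0"
    and iso: "isometric_on UNIV I J q (\<lambda>x. l * q' x)"
  shows "isometric_on K I J q (\<lambda>x. - coeff p 0 * q' x)"
proof -
  have E: "is_subfield (adjoin K l)" by (rule adjoin_subfield[OF K p])
  have KE: "K \<subseteq> adjoin K l" and lE: "l \<in> adjoin K l" using adjoin_base[OF K] by auto
  obtain M where M: "has_degree (adjoin K l) M" "N = degree p * M"
    using degree_tower[OF K N(1) p] by blast
  then have odd: "odd (degree p)" "odd M" using N(2) by auto
  have "isometric_on (adjoin K l) I J q (\<lambda>x. l * q' x)"
  proof (rule anisotropic_iso_descent[OF E M(1) odd(2) form_over_mono[OF q KE]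
        form_over_scale[OF E form_over_mono[OF q' KE] lE] an _ card iso])
    show "anisotropic UNIV J (\<lambda>x. l * q' x)" using an' l0 by (simp add: anisotropic_def)
  qed
  then show ?thesis
    using similitude_descent[OF K q q' _ _ p odd(1) l0 card] anisotropic_mono an an' subset_UNIV by metis
qed

section \<open>Witt decomposition and cancellation\<close>

text \<open>An isotropic vector outside the radical; in every characteristic it lies in a hyperbolic
  plane.\<close>

definition has_hyperbolic :: "'a::field set \<Rightarrow> 'n set \<Rightarrow> ('a ^ 'n \<Rightarrow> 'a) \<Rightarrow> bool" where
  "has_hyperbolic S I q \<longleftrightarrow> (\<exists>v\<in>coord_space S I. \<exists>w\<in>coord_space S I. q v = 0 \<and> polar q v w \<noteq> 0)"

text \<open>The axis \<open>p\<close> spans a null line in the radical. Quantifying over all scalars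
  makes this usable over \<open>K\<close> and over L alike.\<close>

definition null_at :: "('a::field ^ 'n \<Rightarrow> 'a) \<Rightarrow> 'n set \<Rightarrow> 'n \<Rightarrow> bool" where
  "null_at q I p \<longleftrightarrow> (\<forall>x\<in>coord_space UNIV I. \<forall>c. q (x + c *s axis p 1) = q x)"

text \<open>The axes \<open>p\<close> and \<open>r\<close> span a hyperbolic plane that is split off
  orthogonally.\<close>

definition split_at :: "('a::field ^ 'n \<Rightarrow> 'a) \<Rightarrow> 'n set \<Rightarrow> 'n \<Rightarrow> 'n \<Rightarrow> bool" where
  "split_at q I p r \<longleftrightarrow> (\<forall>x\<in>coord_space UNIV I.
     q x = x $ p * x $ r + q (x - x $ p *s axis p 1 - x $ r *s axis r 1))"

lemmas UNIV_closed = coord_space_closed[OF is_subfield_UNIV, simplified]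

lemma polar_iso:
  assumes "is_subfield S" "linear_over S (coord_space S I) f" "\<And>x. x \<in> coord_space S I \<Longrightarrow> q' (f x) = q x"
    and "x \<in> coord_space S I" "y \<in> coord_space S I"
  shows "polar q' (f x) (f y) = polar q x y"
proof -
  have "f (x + y) = f x + f y" using assms(2,4,5) by (simp add: linear_over_def)
  then show ?thesis
    using assms(3)[OF assms(4)] assms(3)[OF assms(5)] assms(3)[OF coord_space_closed(2)[OF assms(1,4,5)]]
    by (simp add: polar_def)
qed

lemma has_hyperbolic_iso:
  assumes S: "is_subfield S" and "isometric_on S I J q q'" "has_hyperbolic S I q"
  shows "has_hyperbolic S J q'"
proof -
  obtain f where f: "linear_over S (coord_space S I) f"
    "\<And>x. x \<in> coord_space S I \<Longrightarrow> f x \<in> coord_space S J"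
    "\<And>x. x \<in> coord_space S I \<Longrightarrow> q' (f x) = q x"
    using isometric_onE[OF S assms(2)] by metis
  obtain v w where "v \<in> coord_space S I" "w \<in> coord_space S I" "q v = 0" "polar q v w \<noteq> 0"
    using assms(3) by (auto simp: has_hyperbolic_def)
  then show ?thesis unfolding has_hyperbolic_def using polar_iso[where f = f and q = q and q' = q', OF S f(1,3)] f(2,3) by metis
qed

lemma has_hyperbolic_scale:
  assumes "c \<noteq> 0"
  shows "has_hyperbolic S I (\<lambda>x. c * q x) \<longleftrightarrow> has_hyperbolic S I q"
proof -
  have "polar (\<lambda>x. c * q x) v w = c * polar q v w" for v w by (simp add: polar_def algebra_simps)
  then show ?thesis using assms by (simp add: has_hyperbolic_def)
qed

lemma has_hyperbolic_mono:
  assumes "has_hyperbolic S I q" "S \<subseteq> S'" "I \<subseteq> I'"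
  shows "has_hyperbolic S' I' q"
  using assms(1) coord_space_mono[OF assms(2,3)] unfolding has_hyperbolic_def by blast

text \<open>Orthogonality is tested on axes, which are rational over every subfield; a radical
  vector over \<open>K\<close> is therefore still radical over L.\<close>

lemma polar_vanish:
  fixes q :: "'a::field ^ 'n::finite \<Rightarrow> 'a"
  assumes q: "form_over UNIV q" and "\<And>i. i \<in> I \<Longrightarrow> polar q v (axis i 1) = 0" "w \<in> coord_space S I"
  shows "polar q v w = 0"
proof -
  have "polar q v (\<Sum>i\<in>A. w $ i *s axis i 1) = 0" if "A \<subseteq> I" for A
    using finite[of A] that
    by (induction A rule: finite_induct) (auto simp: form_over_polar[OF q] assms(2))
  then show ?thesis using coord_space_expand[OF assms(3)] by (metis order_refl)
qed

text \<open>The shear \<open>f\<close> replaces an axis \<open>p\<close> on which \<open>v\<close>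
  has a nonzero coordinate by \<open>v\<close> itself, and the pulled-back form no longer sees the
  coordinate \<open>p\<close>. As \<open>f\<close> is defined over \<open>K\<close>, it gives the
  isometry over \<open>K\<close> and over L at once.\<close>

lemma null_normal_form:
  fixes q :: "'a::field ^ 'n::finite \<Rightarrow> 'a"
  assumes K: "is_subfield K" and q: "form_over K q" and v: "v \<in> coord_space K I" "v \<noteq> 0" "q v = 0"
    and rad: "\<And>w. w \<in> coord_space K I \<Longrightarrow> polar q v w = 0"
  shows "\<exists>p\<in>I. \<exists>q'. form_over K q' \<and> isometric_on K I I q q' \<and> isometric_on UNIV I I q q' \<and> null_at q' I p"
proof -
  have qU: "form_over UNIV q" using form_over_mono[OF q] by blast
  obtain p where vp: "v $ p \<noteq> 0" using v(2) by (auto simp: vec_eq_iff)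
  then have p: "p \<in> I" using v(1) by (auto simp: coord_space_def)
  define f where "f x = x + x $ p *s (v - axis p 1)" for x
  have lin: "linear_over S V f" for S V
    by (simp add: linear_over_def f_def vec_eq_iff algebra_simps)
  have fS: "f x \<in> coord_space S I" if S: "is_subfield S" "K \<subseteq> S" and x: "x \<in> coord_space S I" for S x
  proof -
    have "v \<in> coord_space S I" using v(1) coord_space_mono[OF S(2) order_refl] by blast
    moreover have "x $ p \<in> S" using x by (simp add: coord_space_def)
    ultimately show ?thesis unfolding f_def by (intro coord_space_closed[OF S(1)] x p)
  qed
  have ker: "x = 0" if "f x = 0" for x
  proof -
    have "f x $ p = x $ p * v $ p" by (simp add: f_def axis_def algebra_simps)
    then have "x $ p = 0" using that vp by simp
    then show ?thesis using that by (simp add: f_def)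
  qed
  have iso: "isometric_on S I I q (\<lambda>x. q (f x))" if S: "is_subfield S" "K \<subseteq> S" for S
    by (rule isometric_on_sym[OF S(1)], rule isometric_onI[OF S(1) lin fS[OF S]]) (auto intro: ker)
  have "form_over K (\<lambda>x. q (f x))"
  proof (rule form_over_comp[OF K q lin])
    fix i
    have "v \<in> coord_space K UNIV" using v(1) by (auto simp: coord_space_def)
    then show "f (axis i 1) \<in> coord_space K UNIV"
      unfolding f_def by (intro coord_space_closed[OF K]) (auto simp: axis_def subfield_closed[OF K])
  qed
  moreover have "null_at (\<lambda>x. q (f x)) I p"
    unfolding null_at_def
  proof (intro ballI allI)
    fix x :: "'a ^ 'n" and c assume x: "x \<in> coord_space UNIV I"
    have "f (x + c *s axis p 1) = f x + c *s v"
      by (simp add: f_def vec_eq_iff axis_def algebra_simps)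
    moreover have "polar q v (f x) = 0"
      by (rule polar_vanish[OF qU _ fS[OF is_subfield_UNIV subset_UNIV x]])
        (rule rad, rule coord_space_closed(6)[OF K])
    ultimately show "q (f (x + c *s axis p 1)) = q (f x)"
      using v(3) form_over_polar(6)[OF qU, of "f x" v] by (simp add: form_over_polar(1,2,12)[OF qU])
  qed
  ultimately show ?thesis
    using p iso[OF K] iso[OF is_subfield_UNIV] by (intro bexI[of _ p] exI[of _ "\<lambda>x. q (f x)"]) auto
qed

text \<open>The map \<open>f\<close> sends two axes to a hyperbolic pair \<open>v\<close>,
  \<open>w\<close> and projects the other coordinates to the orthogonal complement of that
  pair.\<close>

lemma hyperbolic_normal_form:
  fixes q :: "'a::field ^ 'n::finite \<Rightarrow> 'a"
  assumes K: "is_subfield K" and q: "form_over K q" and hyp: "has_hyperbolic K I q"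
  shows "\<exists>p\<in>I. \<exists>r\<in>I. \<exists>q'. p \<noteq> r \<and> form_over K q' \<and> isometric_on K I I q q' \<and> isometric_on UNIV I I q q' \<and> split_at q' I p r"
proof -
  have qU: "form_over UNIV q" using form_over_mono[OF q] by blast
  note fp = form_over_polar[OF qU]
  obtain v w0 where v: "v \<in> coord_space K I" "q v = 0" and w0: "w0 \<in> coord_space K I" "polar q v w0 \<noteq> 0"
    using hyp by (auto simp: has_hyperbolic_def)
  define w1 where "w1 = inverse (polar q v w0) *s w0"
  \<comment> \<open>With the pairing of \<open>v\<close> and \<open>w1\<close> normalised to 1,
    subtracting \<open>q w1\<close> times \<open>v\<close> makes the partner isotropic without
    changing its pairing with \<open>v\<close>.\<close>
  define w where "w = w1 - q w1 *s v"
  have w1: "w1 \<in> coord_space K I" unfolding w1_def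
    by (intro coord_space_closed[OF K] subfield_closed[OF K] form_over_polar_closed[OF K q, of _ I] v w0)
  have w: "w \<in> coord_space K I" unfolding w_def
    by (intro coord_space_closed[OF K] form_over_closed[OF K q, of _ I] v w1)
  have vv: "polar q v v = 0" using v by (simp add: fp)
  have vw1: "polar q v w1 = 1" using w0 by (simp add: w1_def fp)
  have vw: "polar q v w = 1" using vw1 vv by (simp add: w_def fp(10,12))
  have wv: "polar q w v = 1" using vw fp(6) by metis
  have qw: "q w = 0"
  proof -
    have "q w = q w1 + (q w1) ^ 2 * q v - q w1 * polar q w1 v" unfolding w_def by (simp add: fp(2,5,12))
    then show ?thesis using v vw1 fp(6)[of w1 v] by simp
  qed
  have ww: "polar q w w = 0" using qw by (simp add: fp)
  have "v \<noteq> 0" using vw by (auto simp: fp)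
  then obtain p where vp: "v $ p \<noteq> 0" by (auto simp: vec_eq_iff)
  \<comment> \<open>Clearing the coordinate \<open>p\<close> of \<open>w\<close> by means of
    \<open>v\<close> exhibits a nonzero 2 by 2 minor of \<open>v\<close>, \<open>w\<close> at
    \<open>p\<close>, \<open>r\<close>; this is what makes the exchange of axes injective.\<close>
  define z where "z = w - (w $ p / v $ p) *s v"
  have "polar q v z = 1" unfolding z_def using vw vv by (simp add: fp(10,12))
  then have "z \<noteq> 0" by (auto simp: fp)
  then obtain r where zr: "z $ r \<noteq> 0" by (auto simp: vec_eq_iff)
  have pr: "p \<noteq> r" using zr vp by (auto simp: z_def)
  have pI: "p \<in> I" using vp v(1) by (auto simp: coord_space_def)
  have rI: "r \<in> I"
  proof (rule ccontr)
    assume "r \<notin> I"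
    then have "v $ r = 0" "w $ r = 0" using v(1) w by (auto simp: coord_space_def)
    then show False using zr by (simp add: z_def)
  qed
  define x0 where "x0 x = x - x $ p *s axis p 1 - x $ r *s axis r (1::'a)" for x
  \<comment> \<open>The orthogonal projection of \<open>x0 x\<close> away from the hyperbolic
    plane.\<close>
  define y where "y x = x0 x - polar q (x0 x) w *s v - polar q (x0 x) v *s w" for x
  define f where "f x = y x + x $ p *s v + x $ r *s w" for x
  have x0_lin: "x0 (x + x') = x0 x + x0 x'" "x0 (c *s x) = c *s x0 x" for x x' c
    by (simp_all add: x0_def vec_eq_iff algebra_simps)
  have lin: "linear_over S V f" for S V
    unfolding linear_over_def f_def y_def x0_lin fp(7,11)
    by (simp add: vec_eq_iff algebra_simps)
  have x0S: "x0 x \<in> coord_space S I" if "is_subfield S" "x \<in> coord_space S I" for S x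
    unfolding x0_def using that(2) by (intro coord_space_closed[OF that(1)] pI rI) (auto simp: coord_space_def)
  have fS: "f x \<in> coord_space S I" if S: "is_subfield S" "K \<subseteq> S" and x: "x \<in> coord_space S I" for S x
  proof -
    have vwS: "v \<in> coord_space S I" "w \<in> coord_space S I"
      using v(1) w coord_space_mono[OF S(2) order_refl] by blast+
    moreover have "x $ p \<in> S" "x $ r \<in> S" using x by (auto simp: coord_space_def)
    moreover have "polar q (x0 x) u \<in> S" if "u \<in> coord_space S I" for u
      by (rule form_over_polar_closed[OF S(1) form_over_mono[OF q S(2)] x0S[OF S(1) x] that])
    ultimately show ?thesis unfolding f_def y_def by (intro coord_space_closed[OF S(1)] x0S[OF S(1)] x)
  qed
  have ker: "x = 0" if "f x = 0" for x
  proof -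
    define a where "a = polar q (x0 x) w - x $ p"
    define b where "b = polar q (x0 x) v - x $ r"
    have "x0 x = a *s v + b *s w"
      using that by (simp add: f_def y_def a_def b_def vec_eq_iff algebra_simps)
    moreover have "x0 x $ p = 0" "x0 x $ r = 0" using pr by (auto simp: x0_def axis_def)
    ultimately have ab: "a * v $ p + b * w $ p = 0" "a * v $ r + b * w $ r = 0" by (auto simp: vec_eq_iff)
    have "a = - b * w $ p / v $ p" using ab(1) vp by (simp add: field_simps add_eq_0_iff)
    then have "b * z $ r = 0" using ab(2) by (simp add: z_def algebra_simps)
    then have "b = 0" using zr by simp
    then have "a = 0" using ab vp by simp
    have "x0 x = 0" using \<open>x0 x = a *s v + b *s w\<close> \<open>a = 0\<close> \<open>b = 0\<close> by simp
    then have "x $ p = 0" "x $ r = 0" using \<open>a = 0\<close> \<open>b = 0\<close> by (auto simp: a_def b_def fp)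
    then show "x = 0" using \<open>x0 x = 0\<close> by (simp add: x0_def)
  qed
  have iso: "isometric_on S I I q (\<lambda>x. q (f x))" if S: "is_subfield S" "K \<subseteq> S" for S
    by (rule isometric_on_sym[OF S(1)], rule isometric_onI[OF S(1) lin fS[OF S]]) (auto intro: ker)
  have "form_over K (\<lambda>x. q (f x))"
  proof (rule form_over_comp[OF K q lin])
    fix i :: 'n
    have e: "axis i 1 \<in> coord_space K UNIV" for i :: 'n by (intro coord_space_closed[OF K]) auto
    have vwK: "v \<in> coord_space K UNIV" "w \<in> coord_space K UNIV" using v(1) w by (auto simp: coord_space_def)
    have aK: "axis i 1 $ j \<in> K" for j using e[of i] by (simp add: coord_space_def)
    have x0K: "x0 (axis i 1) \<in> coord_space K UNIV"
      unfolding x0_def by (intro coord_space_closed(3,5)[OF K] e aK)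
    show "f (axis i 1) \<in> coord_space K UNIV"
      unfolding f_def y_def
      by (intro coord_space_closed(2,3,5)[OF K] x0K vwK aK form_over_polar_closed[OF K q x0K])
  qed
  moreover have "split_at (\<lambda>x. q (f x)) I p r"
    unfolding split_at_def
  proof
    fix x :: "'a ^ 'n" assume "x \<in> coord_space UNIV I"
    have yv: "polar q (y x) v = 0" unfolding y_def by (simp add: fp(9,11) vv wv)
    have yw: "polar q (y x) w = 0" unfolding y_def by (simp add: fp(9,11) vw ww)
    have x0x0: "x0 (x0 x) = x0 x" and x0p: "x0 x $ p = 0" "x0 x $ r = 0"
      using pr by (auto simp: x0_def axis_def vec_eq_iff)
    have "q (f x) = q (y x) + x $ p * x $ r"
      unfolding f_def by (simp add: fp(1,2,7,8,11,12) v qw yv yw vw)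
    moreover have "f (x0 x) = y x" unfolding f_def y_def x0x0 x0p by simp
    ultimately show "q (f x) = x $ p * x $ r + q (f (x - x $ p *s axis p 1 - x $ r *s axis r 1))"
      unfolding x0_def[symmetric] by simp
  qed
  ultimately show ?thesis
    using pr pI rI iso[OF K] iso[OF is_subfield_UNIV]
    by (intro bexI[of _ p] bexI[of _ r] exI[of _ "\<lambda>x. q (f x)"]) auto
qed

text \<open>The reflection in \<open>x = u - e\<close> exists because \<open>q x\<close> equals
  minus the polar value of \<open>u\<close> and \<open>e\<close>, which is nonzero; the formula
  divides by \<open>q x\<close> and not by 2.\<close>

lemma reflection_swap:
  fixes q :: "'a::field ^ 'n::finite \<Rightarrow> 'a"
  assumes q: "form_over UNIV q" and u: "u \<in> coord_space UNIV J" "q u = 0"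
    and e: "e \<in> coord_space UNIV J" "q e = 0" and ue: "polar q u e \<noteq> 0"
  shows "\<exists>g. linear_over UNIV (coord_space UNIV J) g \<and> bij_betw g (coord_space UNIV J) (coord_space UNIV J) \<and>
    (\<forall>x\<in>coord_space UNIV J. q (g x) = q x) \<and> g u = e"
proof -
  note fp = form_over_polar[OF q]
  define x where "x = u - e"
  have x: "x \<in> coord_space UNIV J" unfolding x_def by (intro UNIV_closed u e)
  have qx: "q x = - polar q u e" using u e by (simp add: x_def fp)
  then have qx0: "q x \<noteq> 0" using ue by simp
  define g where "g y = y - (polar q x y / q x) *s x" for y
  have gg: "g (g y) = y" for y
  proof -
    have "polar q x (g y) = - polar q x y"
      unfolding g_def using qx0 by (simp add: fp(10,12,15))
    then have "g (g y) = g y + (polar q x y / q x) *s x"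
      unfolding g_def[of "g y"] by (simp add: vec_eq_iff)
    then show ?thesis by (simp add: g_def)
  qed
  have gJ: "g y \<in> coord_space UNIV J" if "y \<in> coord_space UNIV J" for y
    unfolding g_def by (intro UNIV_closed that x)
  have "linear_over UNIV (coord_space UNIV J) g"
    unfolding linear_over_def g_def fp(8,12)
    by (simp add: vec_eq_iff algebra_simps add_divide_distrib)
  moreover have "bij_betw g (coord_space UNIV J) (coord_space UNIV J)"
    by (rule bij_betw_byWitness[of _ g]) (auto simp: gg gJ)
  moreover have "q (g y) = q y" for y
    unfolding g_def using qx0 by (simp add: fp(2,5,12) fp(6)[of y x] power2_eq_square)
  moreover have "g u = e"
  proof -
    have "polar q x u = q x" unfolding qx using u by (simp add: x_def fp(9,15) fp(6)[of e u])
    then show ?thesis using qx0 by (simp add: g_def x_def)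
  qed
  ultimately show ?thesis by blast
qed

text \<open>One reflection works unless \<open>u\<close> and \<open>e\<close> are orthogonal; in
  that case two reflections pass through an isotropic \<open>z\<close> orthogonal to
  neither.\<close>

lemma isotropic_transitive:
  fixes q :: "'a::field ^ 'n::finite \<Rightarrow> 'a"
  assumes q: "form_over UNIV q" and u: "u \<in> coord_space UNIV J" "q u = 0"
    and e: "e \<in> coord_space UNIV J" "q e = 0"
    and w: "w \<in> coord_space UNIV J" "polar q u w \<noteq> 0" and h: "h \<in> coord_space UNIV J" "polar q e h \<noteq> 0"
  shows "\<exists>g. linear_over UNIV (coord_space UNIV J) g \<and> bij_betw g (coord_space UNIV J) (coord_space UNIV J) \<and>
    (\<forall>x\<in>coord_space UNIV J. q (g x) = q x) \<and> g u = e"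
proof -
  note fp = form_over_polar[OF q]
  let ?V = "coord_space UNIV J :: ('a ^ 'n) set"
  have norm: "\<exists>w'\<in>?V. q w' = 0 \<and> polar q u w' = 1"
    if u: "u \<in> ?V" "q u = 0" and w: "w \<in> ?V" "polar q u w \<noteq> 0" for u w
  proof -
    define w1 where "w1 = inverse (polar q u w) *s w"
    have uu: "polar q u u = 0" using u by (simp add: fp(15))
    have uw1: "polar q u w1 = 1" using w by (simp add: w1_def fp)
    have "polar q u (w1 - q w1 *s u) = 1" using uw1 uu by (simp add: fp(10,12))
    moreover have "q (w1 - q w1 *s u) = 0"
      using uw1 u fp(6)[of w1 u] by (simp add: fp(2,5,12))
    moreover have "w1 - q w1 *s u \<in> ?V" unfolding w1_def by (intro UNIV_closed u w)
    ultimately show ?thesis by blast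
  qed
  obtain w' where w': "w' \<in> ?V" "q w' = 0" "polar q u w' = 1" using norm[OF u w] by blast
  obtain h' where h': "h' \<in> ?V" "q h' = 0" "polar q e h' = 1" using norm[OF e h] by blast
  have "polar q u e \<noteq> 0 \<or> (\<exists>z\<in>?V. q z = 0 \<and> polar q u z \<noteq> 0 \<and> polar q z e \<noteq> 0)"
  proof (cases "polar q u e \<noteq> 0 \<or> polar q w' e \<noteq> 0 \<or> polar q u h' \<noteq> 0")
    case True
    then show ?thesis using w' h' fp(6)[of h' e] by auto
  next
    case False
    \<comment> \<open>When neither \<open>w'\<close> nor \<open>h'\<close> serves as
      \<open>z\<close>, their sum pairs to 1 with both \<open>u\<close> and \<open>e\<close>;
      subtracting a multiple of \<open>u\<close> removes its value while keeping both
      pairings.\<close>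
    define z where "z = w' + h' - polar q w' h' *s u"
    have "q z = 0"
      using False w' h' u fp(6)[of w' u] fp(6)[of h' u] unfolding z_def by (simp add: fp(1,2,5,7,12))
    moreover have "polar q u z = 1"
      using False w' u unfolding z_def by (simp add: fp(8,10,12,15))
    moreover have "polar q z e = 1"
      using False h' fp(6)[of h' e] unfolding z_def by (simp add: fp(7,9,11))
    moreover have "z \<in> ?V" unfolding z_def by (intro UNIV_closed w' h' u)
    ultimately show ?thesis by auto
  qed
  then show ?thesis
  proof
    assume "polar q u e \<noteq> 0"
    then show ?thesis by (rule reflection_swap[OF q u e])
  next
    assume "\<exists>z\<in>?V. q z = 0 \<and> polar q u z \<noteq> 0 \<and> polar q z e \<noteq> 0"
    then obtain z where z: "z \<in> ?V" "q z = 0" "polar q u z \<noteq> 0" "polar q z e \<noteq> 0" by blast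
    obtain g where g: "linear_over UNIV ?V g" "bij_betw g ?V ?V" "\<forall>x\<in>?V. q (g x) = q x" "g u = z"
      using reflection_swap[OF q u z(1,2,3)] by blast
    obtain k where k: "linear_over UNIV ?V k" "bij_betw k ?V ?V" "\<forall>x\<in>?V. q (k x) = q x" "k z = e"
      using reflection_swap[OF q z(1,2) e z(4)] by blast
    have into: "g x \<in> ?V" if "x \<in> ?V" for x using g(2) that by (auto simp: bij_betw_def)
    have "linear_over UNIV ?V (k \<circ> g)"
      using g(1) k(1) into by (simp add: linear_over_def)
    moreover have "bij_betw (k \<circ> g) ?V ?V" by (rule bij_betw_trans[OF g(2) k(2)])
    moreover have "\<forall>x\<in>?V. q ((k \<circ> g) x) = q x" "(k \<circ> g) u = e" using g k into by simp_all
    ultimately show ?thesis by blast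
  qed
qed

lemma split_at_polar:
  fixes q :: "'a::field ^ 'n::finite \<Rightarrow> 'a"
  assumes q: "form_over UNIV q" and s: "split_at q I p r" and pr: "p \<in> I" "p \<noteq> r" and x: "x \<in> coord_space UNIV I"
  shows "q (axis p 1) = 0" "polar q (axis p 1) x = x $ r"
proof -
  have e: "axis p 1 \<in> coord_space UNIV I" by (intro UNIV_closed pr)
  have xe: "axis p 1 + x \<in> coord_space UNIV I" by (intro UNIV_closed pr x)
  have "axis p 1 - axis p 1 $ p *s axis p 1 - axis p 1 $ r *s axis r (1::'a) = 0"
    using pr by (simp add: axis_def vec_eq_iff)
  then show 1: "q (axis p 1) = 0"
    using s e pr form_over_polar(3)[OF q] unfolding split_at_def by (auto simp: axis_def)
  have "(axis p 1 + x) - (axis p 1 + x) $ p *s axis p 1 - (axis p 1 + x) $ r *s axis r (1::'a)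
      = x - x $ p *s axis p 1 - x $ r *s axis r 1"
    using pr by (simp add: axis_def vec_eq_iff algebra_simps)
  then have "q (axis p 1 + x) = (axis p 1 + x) $ p * (axis p 1 + x) $ r + q (x - x $ p *s axis p 1 - x $ r *s axis r 1)"
    using s xe unfolding split_at_def by metis
  moreover have "q x = x $ p * x $ r + q (x - x $ p *s axis p 1 - x $ r *s axis r 1)"
    using s x unfolding split_at_def by blast
  ultimately show "polar q (axis p 1) x = x $ r"
    using pr 1 by (simp add: polar_def axis_def algebra_simps)
qed

text \<open>After an isometry moves the image of the axis \<open>p\<close> to the axis
  \<open>a\<close>, vectors orthogonal to the first go to vectors orthogonal to the second. Dropping
  the coordinate \<open>a\<close> then preserves the form and is injective on vectors without
  coordinate \<open>p\<close>.\<close>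

lemma hyperbolic_cancel:
  fixes q q' :: "'a::field ^ 'n::finite \<Rightarrow> 'a"
  assumes q: "form_over UNIV q" and q': "form_over UNIV q'"
    and s: "split_at q I p r" "p \<in> I" "r \<in> I" "p \<noteq> r"
    and s': "split_at q' J a b" "a \<in> J" "b \<in> J" "a \<noteq> b"
    and c: "c \<noteq> 0" and card: "card I = card J" and iso: "isometric_on UNIV I J q (\<lambda>x. c * q' x)"
  shows "isometric_on UNIV (I - {p, r}) (J - {a, b}) q (\<lambda>x. c * q' x)"
proof -
  let ?V = "coord_space UNIV I :: ('a ^ 'n) set" and ?W = "coord_space UNIV J :: ('a ^ 'n) set"
  define Q where "Q = (\<lambda>x. c * q' x)"
  have Q: "form_over UNIV Q" unfolding Q_def by (rule form_over_scale[OF is_subfield_UNIV q']) simp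
  have Qpolar: "polar Q x y = c * polar q' x y" for x y by (simp add: Q_def polar_def algebra_simps)
  have eP: "axis p 1 \<in> ?V" "axis r 1 \<in> ?V" "axis a 1 \<in> ?W" "axis b 1 \<in> ?W"
    by (intro UNIV_closed s s')+
  obtain f0 where f0: "linear_over UNIV ?V f0" "bij_betw f0 ?V ?W" "\<And>x. x \<in> ?V \<Longrightarrow> Q (f0 x) = q x"
    using iso unfolding isometric_on_def Q_def by blast
  have into0: "f0 x \<in> ?W" if "x \<in> ?V" for x using f0(2) that by (auto simp: bij_betw_def)
  have p0: "polar Q (f0 x) (f0 y) = polar q x y" if "x \<in> ?V" "y \<in> ?V" for x y
    by (rule polar_iso[where f = f0 and q = q and q' = Q, OF is_subfield_UNIV f0(1,3) that])
  have "\<exists>g. linear_over UNIV ?W g \<and> bij_betw g ?W ?W \<and> (\<forall>x\<in>?W. Q (g x) = Q x) \<and> g (f0 (axis p 1)) = axis a 1"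
  proof (rule isotropic_transitive[OF Q])
    show "f0 (axis p 1) \<in> ?W" "f0 (axis r 1) \<in> ?W" "axis a 1 \<in> ?W" "axis b 1 \<in> ?W" by (intro into0 eP)+
    show "Q (f0 (axis p 1)) = 0" using f0(3)[OF eP(1)] split_at_polar(1)[OF q s(1,2,4) eP(1)] by simp
    show "Q (axis a 1) = 0" unfolding Q_def using split_at_polar(1)[OF q' s'(1,2,4) eP(3)] by simp
    show "polar Q (f0 (axis p 1)) (f0 (axis r 1)) \<noteq> 0"
      using p0[OF eP(1,2)] split_at_polar(2)[OF q s(1,2,4) eP(2)] by simp
    show "polar Q (axis a 1) (axis b 1) \<noteq> 0"
      unfolding Qpolar using split_at_polar(2)[OF q' s'(1,2,4) eP(4)] c by simp
  qed
  then obtain g where g: "linear_over UNIV ?W g" "bij_betw g ?W ?W" "\<And>x. x \<in> ?W \<Longrightarrow> Q (g x) = Q x"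
      "g (f0 (axis p 1)) = axis a 1" by blast
  define f where "f = g \<circ> f0"
  have f: "linear_over UNIV ?V f" "bij_betw f ?V ?W" "\<And>x. x \<in> ?V \<Longrightarrow> Q (f x) = q x" "f (axis p 1) = axis a 1"
    unfolding f_def using g f0 into0 bij_betw_trans[OF f0(2) g(2)] by (simp_all add: linear_over_def)
  have into: "f x \<in> ?W" if "x \<in> ?V" for x using f(2) that by (auto simp: bij_betw_def)
  have sub: "coord_space UNIV (I - {p, r}) \<subseteq> ?V" by (rule coord_space_mono) auto
  \<comment> \<open>The coordinate \<open>b\<close> is the pairing with the axis \<open>a\<close>.
    Once it is zero, the product term of \<open>split_at\<close> vanishes, so the coordinate
    \<open>a\<close> does not affect the value.\<close>
  have fb: "f x $ b = 0" if x: "x \<in> coord_space UNIV (I - {p, r})" for x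
  proof -
    have xV: "x \<in> ?V" using x sub by blast
    have "c * f x $ b = polar Q (f (axis p 1)) (f x)"
      unfolding Qpolar f(4) using split_at_polar(2)[OF q' s'(1,2,4) into[OF xV]] by simp
    also have "\<dots> = polar q (axis p 1) x" by (rule polar_iso[where f = f and q = q and q' = Q, OF is_subfield_UNIV f(1,3) eP(1) xV])
    also have "\<dots> = x $ r" by (rule split_at_polar(2)[OF q s(1,2,4) xV])
    also have "\<dots> = 0" using x by (simp add: coord_space_def)
    finally show ?thesis using c by simp
  qed
  have "isometric_on UNIV (I - {p, r}) (J - {a, b}) q Q"
  proof (rule isometric_onI[OF is_subfield_UNIV, of _ "\<lambda>x. f x - f x $ a *s axis a 1"])
    show "linear_over UNIV (coord_space UNIV (I - {p, r})) (\<lambda>x. f x - f x $ a *s axis a 1)"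
      using f(1) sub by (auto simp: linear_over_def vec_eq_iff algebra_simps subset_iff)
    show "card (I - {p, r}) = card (J - {a, b})"
      using card s s' by (simp add: card_Diff_subset)
    fix x :: "'a ^ 'n" assume x: "x \<in> coord_space UNIV (I - {p, r})"
    then have xV: "x \<in> ?V" using sub by blast
    show "f x - f x $ a *s axis a 1 \<in> coord_space UNIV (J - {a, b})"
      using into[OF xV] fb[OF x] s'(4) by (auto simp: coord_space_def axis_def)
    have "q' (f x) = q' (f x - f x $ a *s axis a 1)"
      using s'(1) into[OF xV] fb[OF x] unfolding split_at_def by simp
    then show "Q (f x - f x $ a *s axis a 1) = q x" using f(3)[OF xV] by (simp add: Q_def)
    assume "f x - f x $ a *s axis a 1 = 0"
    then have "f x = f x $ a *s f (axis p 1)" using f(4) by simp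
    also have "\<dots> = f (f x $ a *s axis p 1)" using f(1) eP(1) by (simp add: linear_over_def)
    finally have "x = f x $ a *s axis p 1"
      using f(2) xV UNIV_closed(5)[OF eP(1)] by (auto simp: bij_betw_def inj_on_def)
    moreover have "x $ p = 0" using x by (simp add: coord_space_def)
    ultimately show "x = 0" by (metis axis_nth mult.right_neutral vector_smult_component vector_smult_lzero)
  qed
  then show ?thesis by (simp add: Q_def)
qed

text \<open>The isometry need not match the two null lines. It suffices to project along one null
  direction \<open>n\<close> that is transversal both to the hyperplane of vanishing coordinate
  \<open>r\<close> and to the image of the hyperplane of vanishing coordinate
  \<open>p\<close>.\<close>

lemma null_cancel:
  fixes q q' :: "'a::field ^ 'n::finite \<Rightarrow> 'a"
  assumes s: "null_at q I p" "p \<in> I" and s': "null_at q' J r" "r \<in> J"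
    and card: "card I = card J" and iso: "isometric_on UNIV I J q (\<lambda>x. c * q' x)"
  shows "isometric_on UNIV (I - {p}) (J - {r}) q (\<lambda>x. c * q' x)"
proof -
  let ?V = "coord_space UNIV I :: ('a ^ 'n) set" and ?W = "coord_space UNIV J :: ('a ^ 'n) set"
  define Q where "Q = (\<lambda>x. c * q' x)"
  have eP: "axis p 1 \<in> ?V" "axis r 1 \<in> ?W" by (intro UNIV_closed s s')+
  obtain f g where f: "linear_over UNIV ?V f" "linear_over UNIV ?W g"
    "\<And>x. x \<in> ?V \<Longrightarrow> f x \<in> ?W" "\<And>x. x \<in> ?W \<Longrightarrow> g x \<in> ?V"
    "\<And>x. x \<in> ?V \<Longrightarrow> g (f x) = x" "\<And>x. x \<in> ?W \<Longrightarrow> f (g x) = x"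
    "\<And>x. x \<in> ?V \<Longrightarrow> Q (f x) = q x" "\<And>x. x \<in> ?W \<Longrightarrow> q (g x) = Q x"
    using isometric_onE[OF is_subfield_UNIV iso] unfolding Q_def by blast
  have sub: "coord_space UNIV (I - {p}) \<subseteq> ?V" by (rule coord_space_mono) auto
  define z where "z = f (axis p 1)"
  define y where "y = g (axis r 1)"
  have zW: "z \<in> ?W" and yV: "y \<in> ?V" unfolding z_def y_def by (intro f eP)+
  have gz: "g z = axis p 1" unfolding z_def by (intro f eP)
  have Qr: "Q (x + d *s axis r 1) = Q x" if "x \<in> ?W" for x d
    using s'(1) that by (simp add: Q_def null_at_def)
  have Qz: "Q (x + d *s z) = Q x" if x: "x \<in> ?W" for x d
  proof -
    have xz: "x + d *s z \<in> ?W" by (intro UNIV_closed x zW)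
    have "g (x + d *s z) = g x + d *s axis p 1"
      using f(2) x zW UNIV_closed(5)[OF zW] gz by (simp add: linear_over_def)
    then have "Q (x + d *s z) = q (g x + d *s axis p 1)" using f(8)[OF xz] by simp
    also have "\<dots> = Q x" using s(1) f(4,8)[OF x] by (simp add: null_at_def)
    finally show ?thesis .
  qed
  have build: "isometric_on UNIV (I - {p}) (J - {r}) q Q"
    if n: "\<And>x. (x + k x *s n) $ r = 0 \<or> x \<notin> ?W"
      and k: "\<And>x y. k (x + y) = k x + k y" "\<And>c x. k (c *s x) = c * k x"
      and nW: "n \<in> ?W" and Qn: "\<And>x d. x \<in> ?W \<Longrightarrow> Q (x + d *s n) = Q x" and gn: "g n $ p \<noteq> 0"
    for k :: "'a ^ 'n \<Rightarrow> 'a" and n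
  proof (rule isometric_onI[OF is_subfield_UNIV, of _ "\<lambda>x. f x + k (f x) *s n"])
    show "linear_over UNIV (coord_space UNIV (I - {p})) (\<lambda>x. f x + k (f x) *s n)"
      unfolding linear_over_def
    proof (intro conjI ballI)
      fix x y :: "'a ^ 'n" assume "x \<in> coord_space UNIV (I - {p})" "y \<in> coord_space UNIV (I - {p})"
      then have e: "f (x + y) = f x + f y" using f(1) sub unfolding linear_over_def by blast
      show "f (x + y) + k (f (x + y)) *s n = f x + k (f x) *s n + (f y + k (f y) *s n)"
        unfolding e by (simp add: k vec_eq_iff algebra_simps)
    next
      fix d and x :: "'a ^ 'n" assume "x \<in> coord_space UNIV (I - {p})"
      then have e: "f (d *s x) = d *s f x" using f(1) sub unfolding linear_over_def by blast
      show "f (d *s x) + k (f (d *s x)) *s n = d *s (f x + k (f x) *s n)"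
        unfolding e by (simp add: k vec_eq_iff algebra_simps)
    qed
    show "card (I - {p}) = card (J - {r})" using card s s' by simp
    fix x :: "'a ^ 'n" assume x: "x \<in> coord_space UNIV (I - {p})"
    then have xV: "x \<in> ?V" using sub by blast
    have "f x + k (f x) *s n \<in> ?W" by (intro UNIV_closed f xV nW)
    then show "f x + k (f x) *s n \<in> coord_space UNIV (J - {r})"
      using n[of "f x"] f(3)[OF xV] by (auto simp: coord_space_def)
    show "Q (f x + k (f x) *s n) = q x" using Qn f(3,7) xV by simp
    assume "f x + k (f x) *s n = 0"
    then have fx: "f x = (- k (f x)) *s n" by (simp add: vec_eq_iff eq_neg_iff_add_eq_0)
    have "x = g ((- k (f x)) *s n)" using f(5)[OF xV] fx by simp
    also have "\<dots> = (- k (f x)) *s g n"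
      using f(2) nW unfolding linear_over_def by blast
    finally have xg: "x = (- k (f x)) *s g n" .
    then have "x $ p = - k (f x) * g n $ p" by (metis vector_smult_component)
    moreover have "x $ p = 0" using x by (simp add: coord_space_def)
    ultimately have "k (f x) = 0" using gn by simp
    then show "x = 0" using xg by simp
  qed
  \<comment> \<open>Project along a null vector \<open>n\<close> with nonzero \<open>r\<close>-coordinate whose preimage has nonzero
    \<open>p\<close>-coordinate: one of \<open>z\<close>, \<open>axis r 1\<close>, or their difference will do.\<close>
  have "\<exists>n\<in>?W. n $ r \<noteq> 0 \<and> g n $ p \<noteq> 0 \<and> (\<forall>x\<in>?W. \<forall>d. Q (x + d *s n) = Q x)"
  proof (cases "z $ r \<noteq> 0 \<or> y $ p \<noteq> 0")
    case True
    then show ?thesis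
    proof
      assume "z $ r \<noteq> 0"
      then show ?thesis using zW gz Qz by (intro bexI[of _ z]) auto
    next
      assume "y $ p \<noteq> 0"
      then show ?thesis using eP Qr by (intro bexI[of _ "axis r 1"]) (auto simp: y_def)
    qed
  next
    case False
    have nW: "z - axis r 1 \<in> ?W" by (intro UNIV_closed zW eP)
    have "g (z - axis r 1) = axis p 1 - y"
      using linear_over_diff[OF is_subfield_UNIV f(2) zW eP(2)] gz by (simp add: y_def)
    then have "g (z - axis r 1) $ p \<noteq> 0" using False by simp
    moreover have "Q (x + d *s (z - axis r 1)) = Q x" if x: "x \<in> ?W" for x d
    proof -
      have "x + d *s (z - axis r 1) = (x + d *s z) + (- d) *s axis r 1"
        by (simp add: vec_eq_iff algebra_simps)
      then show ?thesis
        using Qr[OF UNIV_closed(2)[OF x UNIV_closed(5)[OF zW]], of d "- d"] Qz[OF x, of d] by metis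
    qed
    ultimately show ?thesis using nW False by (intro bexI[of _ "z - axis r 1"]) auto
  qed
  then obtain n where n: "n \<in> ?W" "n $ r \<noteq> 0" "g n $ p \<noteq> 0" "\<And>x d. x \<in> ?W \<Longrightarrow> Q (x + d *s n) = Q x"
    by blast
  have "isometric_on UNIV (I - {p}) (J - {r}) q Q"
    by (rule build[of "\<lambda>x. - x $ r / n $ r", OF _ _ _ n(1,4,3)]) (use n(2) in \<open>auto simp: field_simps add_divide_distrib\<close>)
  then show ?thesis by (simp add: Q_def)
qed

text \<open>A hyperbolic plane is isometric to each of its nonzero scalings, so a similitude of the
  complements extends with any prescribed factor.\<close>

lemma hyperbolic_extend:
  fixes q q' :: "'a::field ^ 'n::finite \<Rightarrow> 'a"
  assumes K: "is_subfield K"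
    and s: "split_at q I p r" "p \<in> I" "r \<in> I" "p \<noteq> r"
    and s': "split_at q' J a b" "a \<in> J" "b \<in> J" "a \<noteq> b"
    and c: "c \<noteq> 0" "c \<in> K" and card: "card I = card J"
    and iso: "isometric_on K (I - {p, r}) (J - {a, b}) q (\<lambda>x. c * q' x)"
  shows "isometric_on K I J q (\<lambda>x. c * q' x)"
proof -
  let ?V = "coord_space K (I - {p, r})" and ?W = "coord_space K (J - {a, b})"
  obtain f g where f: "linear_over K ?V f" "\<And>x. x \<in> ?V \<Longrightarrow> f x \<in> ?W"
    "\<And>x. x \<in> ?V \<Longrightarrow> g (f x) = x" "\<And>x. x \<in> ?V \<Longrightarrow> c * q' (f x) = q x"
    using isometric_onE[OF K iso] by metis
  define x0 where "x0 x = x - x $ p *s axis p 1 - x $ r *s axis r (1::'a)" for x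
  \<comment> \<open>Dividing by \<open>c\<close> on the second axis compensates the factor
    \<open>c\<close> in front of \<open>q'\<close>.\<close>
  define F where "F x = f (x0 x) + x $ p *s axis a 1 + (x $ r / c) *s axis b (1::'a)" for x
  have x0V: "x0 x \<in> ?V" if "x \<in> coord_space K I" for x
    using that s(4) subfield_closed(1,2)[OF K]
    by (auto simp: coord_space_def x0_def axis_def intro!: subfield_closed[OF K])
  have x0_lin: "x0 (x + y) = x0 x + x0 y" "x0 (d *s x) = d *s x0 x" for x y d
    by (simp_all add: x0_def vec_eq_iff algebra_simps)
  show ?thesis
  proof (rule isometric_onI[OF K, of _ F])
    show "linear_over K (coord_space K I) F"
      using f(1) x0V unfolding linear_over_def F_def x0_lin
      by (simp add: vec_eq_iff algebra_simps add_divide_distrib)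
    fix x assume x: "x \<in> coord_space K I"
    note fx = f(2)[OF x0V[OF x]]
    have xK: "x $ i \<in> K" for i using x by (simp add: coord_space_def)
    have "f (x0 x) \<in> coord_space K J" using fx coord_space_mono[of K K "J - {a, b}" J] by blast
    then show FJ: "F x \<in> coord_space K J"
      unfolding F_def by (intro coord_space_closed[OF K] s' xK subfield_closed[OF K] c)
    have fab: "f (x0 x) $ a = 0" "f (x0 x) $ b = 0" using fx by (auto simp: coord_space_def)
    have Fab: "F x $ a = x $ p" "F x $ b = x $ r / c" using fab s'(4) by (auto simp: F_def axis_def)
    have F0: "F x - F x $ a *s axis a 1 - F x $ b *s axis b 1 = f (x0 x)"
      unfolding Fab by (simp add: F_def)
    have "F x \<in> coord_space UNIV J" using FJ by (auto simp: coord_space_def)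
    then have "c * q' (F x) = c * (F x $ a * F x $ b + q' (f (x0 x)))"
      using s'(1) F0 unfolding split_at_def by metis
    also have "\<dots> = x $ p * x $ r + q (x0 x)"
      unfolding Fab using f(4)[OF x0V[OF x]] c by (simp add: algebra_simps)
    also have "\<dots> = q x"
      using s(1) x unfolding split_at_def x0_def coord_space_def by simp
    finally show "c * q' (F x) = q x" .
    assume F: "F x = 0"
    then have pr: "x $ p = 0" "x $ r = 0" using Fab c by auto
    then have "f (x0 x) = 0" using F0 F by simp
    then have "f (x0 x) = f 0" using linear_over_zero[OF K f(1)] by simp
    then have "x0 x = 0" using f(3)[OF x0V[OF x]] f(3)[OF coord_space_closed(1)[OF K]] by simp
    then show "x = 0" using pr by (simp add: x0_def)
  qed (rule card)
qed

lemma null_extend: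
  fixes q q' :: "'a::field ^ 'n::finite \<Rightarrow> 'a"
  assumes K: "is_subfield K" and s: "null_at q I p" "p \<in> I" and s': "null_at q' J r" "r \<in> J"
    and card: "card I = card J" and iso: "isometric_on K (I - {p}) (J - {r}) q (\<lambda>x. c * q' x)"
  shows "isometric_on K I J q (\<lambda>x. c * q' x)"
proof -
  let ?V = "coord_space K (I - {p})" and ?W = "coord_space K (J - {r})"
  obtain f g where f: "linear_over K ?V f" "\<And>x. x \<in> ?V \<Longrightarrow> f x \<in> ?W"
    "\<And>x. x \<in> ?V \<Longrightarrow> g (f x) = x" "\<And>x. x \<in> ?V \<Longrightarrow> c * q' (f x) = q x"
    using isometric_onE[OF K iso] by metis
  define x0 where "x0 x = x - x $ p *s axis p (1::'a)" for x
  define F where "F x = f (x0 x) + x $ p *s axis r (1::'a)" for x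
  have x0V: "x0 x \<in> ?V" if "x \<in> coord_space K I" for x
    using that subfield_closed(1,2)[OF K]
    by (auto simp: coord_space_def x0_def axis_def intro!: subfield_closed[OF K])
  have x0_lin: "x0 (x + y) = x0 x + x0 y" "x0 (d *s x) = d *s x0 x" for x y d
    by (simp_all add: x0_def vec_eq_iff algebra_simps)
  show ?thesis
  proof (rule isometric_onI[OF K, of _ F])
    show "linear_over K (coord_space K I) F"
      using f(1) x0V unfolding linear_over_def F_def x0_lin
      by (simp add: vec_eq_iff algebra_simps)
    fix x assume x: "x \<in> coord_space K I"
    note fx = f(2)[OF x0V[OF x]]
    have xK: "x $ i \<in> K" for i using x by (simp add: coord_space_def)
    have fJ: "f (x0 x) \<in> coord_space K J" using fx coord_space_mono[of K K "J - {r}" J] by blast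
    then show "F x \<in> coord_space K J"
      unfolding F_def by (intro coord_space_closed[OF K] s' xK)
    have "f (x0 x) \<in> coord_space UNIV J" using fJ by (auto simp: coord_space_def)
    then have "c * q' (F x) = q (x0 x)"
      using s'(1) f(4)[OF x0V[OF x]] by (simp add: F_def null_at_def)
    also have "\<dots> = q (x0 x + x $ p *s axis p 1)"
      using s(1) x0V[OF x] by (auto simp: null_at_def coord_space_def)
    finally show "c * q' (F x) = q x" by (simp add: x0_def)
    assume F: "F x = 0"
    have "F x $ r = x $ p" using fx by (simp add: F_def coord_space_def)
    then have p0: "x $ p = 0" using F by simp
    then have "f (x0 x) = f 0" using F linear_over_zero[OF K f(1)] by (simp add: F_def)
    then have "x0 x = 0" using f(3)[OF x0V[OF x]] f(3)[OF coord_space_closed(1)[OF K]] by simp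
    then show "x = 0" using p0 by (simp add: x0_def)
  qed (rule card)
qed

text \<open>If no isotropic vector pairs nontrivially with anything, a nonzero isotropic vector is
  orthogonal to the whole space.\<close>

lemma isotropic_null_normal_form:
  fixes q :: "'a::field ^ 'n::finite \<Rightarrow> 'a"
  assumes "is_subfield K" "form_over K q" "\<not> has_hyperbolic K I q" "\<not> anisotropic K I q"
  shows "\<exists>p\<in>I. \<exists>q'. form_over K q' \<and> isometric_on K I I q q' \<and> isometric_on UNIV I I q q' \<and> null_at q' I p"
proof -
  obtain v where "v \<in> coord_space K I" "v \<noteq> 0" "q v = 0" using assms(4) by (auto simp: anisotropic_def)
  then show ?thesis
    using null_normal_form[OF assms(1,2)] assms(3) unfolding has_hyperbolic_def by blast
qed

text \<open>Without a hyperbolic pair over \<open>K\<close>, either the form is anisotropic over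
  \<open>K\<close>, hence over L by Springer, or a null line splits off over \<open>K\<close>. In
  the latter case the pair over L survives in the smaller space, and induction applies.\<close>

lemma has_hyperbolic_descent:
  fixes q :: "'a::field ^ 'n::finite \<Rightarrow> 'a"
  assumes K: "is_subfield K" and N: "has_degree K N" "odd N"
    and "form_over K q" "has_hyperbolic UNIV I q"
  shows "has_hyperbolic K I q"
  using assms(4,5)
proof (induction "card I" arbitrary: I q rule: less_induct)
  case less
  show ?case
  proof (rule ccontr)
    assume nh: "\<not> has_hyperbolic K I q"
    have qU: "form_over UNIV q" using form_over_mono[OF less.prems(1)] by blast
    show False
    proof (cases "anisotropic K I q")
      case True
      then have "anisotropic UNIV I q" using springer[OF K N less.prems(1)] by blast
      then show False
        using less.prems(2) form_over_polar(13)[OF qU] by (auto simp: has_hyperbolic_def anisotropic_def)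
    next
      case False
      then obtain p q' where p: "p \<in> I" "form_over K q'" "isometric_on K I I q q'" "isometric_on UNIV I I q q'" "null_at q' I p"
        using isotropic_null_normal_form[OF K less.prems(1) nh] by blast
      have "has_hyperbolic UNIV I q'"
        using has_hyperbolic_iso[OF is_subfield_UNIV p(4)] less.prems(2) .
      then obtain v w where vw: "v \<in> coord_space UNIV I" "w \<in> coord_space UNIV I" "q' v = 0" "polar q' v w \<noteq> 0"
        by (auto simp: has_hyperbolic_def)
      \<comment> \<open>Clearing the null coordinate changes no value, hence no polar value.\<close>
      have red: "x + (- x $ p) *s axis p 1 \<in> coord_space UNIV (I - {p})"
        "q' (x + (- x $ p) *s axis p 1) = q' x" if "x \<in> coord_space UNIV I" for x
      proof -
        show "x + (- x $ p) *s axis p 1 \<in> coord_space UNIV (I - {p})"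
          using that by (auto simp: coord_space_def axis_def)
        show "q' (x + (- x $ p) *s axis p 1) = q' x" using that p(5) unfolding null_at_def by blast
      qed
      have "polar q' (v + (- v $ p) *s axis p 1) (w + (- w $ p) *s axis p 1) = polar q' v w"
      proof -
        have "(v + (- v $ p) *s axis p 1) + (w + (- w $ p) *s axis p 1) = (v + w) + (- (v + w) $ p) *s axis p 1"
          by (simp add: vec_eq_iff algebra_simps)
        then show ?thesis
          unfolding polar_def using red(2)[OF vw(1)] red(2)[OF vw(2)] red(2)[OF UNIV_closed(2)[OF vw(1,2)]] by metis
      qed
      then have "has_hyperbolic UNIV (I - {p}) q'"
        unfolding has_hyperbolic_def using red[OF vw(1)] red[OF vw(2)] vw(3,4) by metis
      moreover have "card (I - {p}) < card I" using p(1) by (intro card_Diff1_less) auto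
      ultimately have "has_hyperbolic K (I - {p}) q'" using less.hyps p(2) by blast
      then have "has_hyperbolic K I q'" by (rule has_hyperbolic_mono) auto
      then show False using nh has_hyperbolic_iso[OF K isometric_on_sym[OF K p(3)]] by blast
    qed
  qed
qed

section \<open>Reduction to the anisotropic case\<close>

lemma anisotropic_iso:
  assumes S: "is_subfield S" and "isometric_on S I J q (\<lambda>x. c * q' x)" "anisotropic S I q"
  shows "anisotropic S J q'"
  unfolding anisotropic_def
proof (intro ballI impI)
  obtain f g where f: "linear_over S (coord_space S I) f" "\<And>x. x \<in> coord_space S J \<Longrightarrow> g x \<in> coord_space S I"
    "\<And>x. x \<in> coord_space S J \<Longrightarrow> f (g x) = x" "\<And>x. x \<in> coord_space S J \<Longrightarrow> q (g x) = c * q' x"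
    using isometric_onE[OF S assms(2)] by metis
  fix x assume x: "x \<in> coord_space S J" "q' x = 0"
  then have "g x = 0" using f(2,4) assms(3) by (simp add: anisotropic_def)
  then show "x = 0" using f(3)[OF x(1)] linear_over_zero[OF S f(1)] by simp
qed

text \<open>Over \<open>K\<close> both forms have a hyperbolic pair, or both are anisotropic, or
  both have only radical isotropic vectors and at least one nonzero such vector. In the two
  isotropic cases a summand is cancelled over L and put back over \<open>K\<close> after induction
  on the dimension.\<close>

theorem similitude_descent_general:
  fixes q q' :: "'a::field ^ 'n::finite \<Rightarrow> 'a"
  assumes K: "is_subfield K" and N: "has_degree K N" "odd N"
    and p: "is_min_poly K l p" and l0: "l \<noteq> 0"
    and "form_over K q" "form_over K q'" "card I = card J" "isometric_on UNIV I J q (\<lambda>x. l * q' x)"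
  shows "isometric_on K I J q (\<lambda>x. - coeff p 0 * q' x)"
  using assms(6-)
proof (induction "card I" arbitrary: I J q q' rule: less_induct)
  case less
  note q = less.prems(1) and q' = less.prems(2) and card = less.prems(3) and iso = less.prems(4)
  note U = is_subfield_UNIV
  have c: "- coeff p 0 \<noteq> 0" "- coeff p 0 \<in> K"
    using min_poly_const_nonzero[OF K p l0] subfield_closed(6)[OF K] by auto
  have reduce: "isometric_on UNIV I J q1 (\<lambda>x. l * q1' x)" if "isometric_on UNIV I I q q1" "isometric_on UNIV J J q' q1'" for q1 q1'
    using isometric_on_trans[OF isometric_on_sym[OF U that(1)] isometric_on_trans[OF iso isometric_on_scale[OF that(2)]]] .
  have lift: "isometric_on K I J q (\<lambda>x. - coeff p 0 * q' x)"
    if "isometric_on K I I q q1" "isometric_on K J J q' q1'" "isometric_on K I J q1 (\<lambda>x. - coeff p 0 * q1' x)" for q1 q1'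
    using isometric_on_trans[OF that(1) isometric_on_trans[OF that(3) isometric_on_scale[OF isometric_on_sym[OF K that(2)]]]] .
  have iso': "isometric_on UNIV J I q' (\<lambda>x. inverse l * q x)"
    using isometric_on_scale[OF isometric_on_sym[OF U iso], of "inverse l"] l0 by (simp flip: mult.assoc)
  \<comment> \<open>Up by enlarging the scalars, across by the similitude over L, and down again by
    \<open>has_hyperbolic_descent\<close>.\<close>
  have hyp_iff: "has_hyperbolic K I q \<longleftrightarrow> has_hyperbolic K J q'"
  proof
    assume "has_hyperbolic K I q"
    then have "has_hyperbolic UNIV I q" by (rule has_hyperbolic_mono) auto
    then have "has_hyperbolic UNIV J q'"
      using has_hyperbolic_iso[OF U iso] has_hyperbolic_scale[OF l0] by blast
    then show "has_hyperbolic K J q'" by (rule has_hyperbolic_descent[OF K N q'])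
  next
    assume "has_hyperbolic K J q'"
    then have "has_hyperbolic UNIV J q'" by (rule has_hyperbolic_mono) auto
    then have "has_hyperbolic UNIV I q"
      using has_hyperbolic_iso[OF U iso'] has_hyperbolic_scale[of "inverse l" UNIV I q] l0 by simp
    then show "has_hyperbolic K I q" by (rule has_hyperbolic_descent[OF K N q])
  qed
  \<comment> \<open>Here Springer's theorem is the way up, and the way down is mere restriction of
    scalars.\<close>
  have anis_iff: "anisotropic K I q \<longleftrightarrow> anisotropic K J q'"
    using springer[OF K N q] springer[OF K N q'] anisotropic_iso[OF U iso] anisotropic_iso[OF U iso']
      anisotropic_mono[of UNIV _ _ K] by blast
  show ?case
  proof (cases "has_hyperbolic K I q")
    case True
    obtain a b q1 where 1: "a \<in> I" "b \<in> I" "a \<noteq> b" "form_over K q1" "isometric_on K I I q q1" "isometric_on UNIV I I q q1"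
        "split_at q1 I a b"
      using hyperbolic_normal_form[OF K q True] by blast
    obtain a' b' q1' where 2: "a' \<in> J" "b' \<in> J" "a' \<noteq> b'" "form_over K q1'" "isometric_on K J J q' q1'" "isometric_on UNIV J J q' q1'"
        "split_at q1' J a' b'"
      using hyperbolic_normal_form[OF K q' True[unfolded hyp_iff]] by blast
    have F: "form_over UNIV q1" "form_over UNIV q1'"
      using form_over_mono[OF 1(4)] form_over_mono[OF 2(4)] by auto
    have "isometric_on UNIV (I - {a, b}) (J - {a', b'}) q1 (\<lambda>x. l * q1' x)"
      by (rule hyperbolic_cancel[OF F 1(7,1,2,3) 2(7,1,2,3) l0 card reduce[OF 1(6) 2(6)]])
    moreover have "card (I - {a, b}) = card (J - {a', b'})"
      using card 1 2 by (simp add: card_Diff_subset)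
    moreover have "card (I - {a, b}) < card I" using 1 by (intro psubset_card_mono) auto
    ultimately have "isometric_on K (I - {a, b}) (J - {a', b'}) q1 (\<lambda>x. - coeff p 0 * q1' x)"
      by (intro less.hyps[OF _ 1(4) 2(4)])
    then show ?thesis
      by (intro lift[OF 1(5) 2(5)] hyperbolic_extend[OF K 1(7,1,2,3) 2(7,1,2,3) c card])
  next
    case False
    show ?thesis
    proof (cases "anisotropic K I q")
      case True
      then show ?thesis
        using anisotropic_similitude_descent[OF K N q q' _ _ card p l0 iso]
          springer[OF K N q] springer[OF K N q'] anis_iff by blast
    next
      case an: False
      obtain a q1 where 1: "a \<in> I" "form_over K q1" "isometric_on K I I q q1" "isometric_on UNIV I I q q1" "null_at q1 I a"
        using isotropic_null_normal_form[OF K q False an] by blast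
      obtain a' q1' where 2: "a' \<in> J" "form_over K q1'" "isometric_on K J J q' q1'" "isometric_on UNIV J J q' q1'" "null_at q1' J a'"
        using isotropic_null_normal_form[OF K q' False[unfolded hyp_iff] an[unfolded anis_iff]] by blast
      have "isometric_on UNIV (I - {a}) (J - {a'}) q1 (\<lambda>x. l * q1' x)"
        by (rule null_cancel[OF 1(5,1) 2(5,1) card reduce[OF 1(4) 2(4)]])
      moreover have "card (I - {a}) = card (J - {a'})" using card 1 2 by simp
      moreover have "card (I - {a}) < card I" using 1 by (intro card_Diff1_less) auto
      ultimately have "isometric_on K (I - {a}) (J - {a'}) q1 (\<lambda>x. - coeff p 0 * q1' x)"
        by (intro less.hyps[OF _ 1(2) 2(2)])
      then show ?thesis
        by (intro lift[OF 1(3) 2(3)] null_extend[OF K 1(5,1) 2(5,1) card])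
    qed
  qed
qed

section \<open>Descent of similarity\<close>

lemma qf_qscale: "qf (qscale c B) = (\<lambda>x. c * qf B x)"
  by (simp add: fun_eq_iff qf_def qscale_def sum_distrib_left mult.assoc)

lemma vec_in_iff_coord_space: "vec_in S x \<longleftrightarrow> x \<in> coord_space S UNIV"
  by (simp add: vec_in_def coord_space_def)

text \<open>The columns of a matrix are the images of the axes; an isometry and its inverse supply
  the matrix pair \<open>T\<close>, \<open>T'\<close>.\<close>

lemma isometric_over_iff_isometric_on:
  fixes A B :: "'a::field ^ 'n::finite ^ 'n"
  assumes S: "is_subfield S"
  shows "isometric_over S A B \<longleftrightarrow> isometric_on S UNIV UNIV (qf A) (qf B)"
proof
  let ?V = "coord_space S UNIV :: ('a ^ 'n) set"
  assume "isometric_over S A B"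
  then obtain T T' where T: "mat_in S T" "mat_in S T'" "T ** T' = mat 1" "T' ** T = mat 1"
      "\<And>x. x \<in> ?V \<Longrightarrow> qf B (T *v x) = qf A x"
    unfolding isometric_over_def vec_in_iff_coord_space by blast
  have into: "M *v x \<in> ?V" if "mat_in S M" "x \<in> ?V" for M x
    using that unfolding coord_space_def mat_in_def matrix_vector_mult_def
    by (auto intro!: subfield_sum[OF S] subfield_closed[OF S])
  have "linear_over S ?V ((*v) T)"
    by (simp add: linear_over_def matrix_vector_right_distrib vector_scalar_commute)
  moreover have "bij_betw ((*v) T) ?V ?V"
    by (rule bij_betw_byWitness[of _ "(*v) T'"]) (auto simp: matrix_vector_mul_assoc T(3,4) intro: into T(1,2))
  ultimately show "isometric_on S UNIV UNIV (qf A) (qf B)"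
    unfolding isometric_on_def using T(5) by blast
next
  let ?V = "coord_space S UNIV :: ('a ^ 'n) set"
  assume iso: "isometric_on S UNIV UNIV (qf A) (qf B)"
  obtain f g where f: "linear_over S ?V f" "linear_over S ?V g"
    "\<And>x. x \<in> ?V \<Longrightarrow> f x \<in> ?V" "\<And>x. x \<in> ?V \<Longrightarrow> g x \<in> ?V"
    "\<And>x. x \<in> ?V \<Longrightarrow> g (f x) = x" "\<And>x. x \<in> ?V \<Longrightarrow> f (g x) = x"
    "\<And>x. x \<in> ?V \<Longrightarrow> qf B (f x) = qf A x" "\<And>x. x \<in> ?V \<Longrightarrow> qf A (g x) = qf B x"
  proof (rule isometric_onE[OF S iso])
    fix f g
    assume "linear_over S ?V f" "linear_over S ?V g"
      "\<And>x. x \<in> ?V \<Longrightarrow> f x \<in> ?V" "\<And>x. x \<in> ?V \<Longrightarrow> g x \<in> ?V"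
      "\<And>x. x \<in> ?V \<Longrightarrow> g (f x) = x" "\<And>x. x \<in> ?V \<Longrightarrow> f (g x) = x"
      "\<And>x. x \<in> ?V \<Longrightarrow> qf B (f x) = qf A x" "\<And>x. x \<in> ?V \<Longrightarrow> qf A (g x) = qf B x"
    then show thesis by (rule that)
  qed
  define M :: "('a ^ 'n \<Rightarrow> 'a ^ 'n) \<Rightarrow> 'a ^ 'n ^ 'n" where "M h = (\<chi> i j. h (axis j 1) $ i)" for h
  have e: "axis j 1 \<in> ?V" for j by (intro coord_space_closed[OF S]) simp
  have MS: "mat_in S (M h)" if "\<And>x. x \<in> ?V \<Longrightarrow> h x \<in> ?V" for h
    using that[OF e] by (simp add: mat_in_def M_def coord_space_def)
  have Mv: "M h *v x = h x" if h: "linear_over S ?V h" and x: "x \<in> ?V" for h x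
  proof -
    have "h x = h (\<Sum>j\<in>UNIV. x $ j *s axis j 1)" using coord_space_expand[OF x] by simp
    also have "\<dots> = (\<Sum>j\<in>UNIV. x $ j *s h (axis j 1))"
      using x by (intro linear_over_sum[OF S h] e) (simp add: coord_space_def)
    finally show ?thesis by (simp add: vec_eq_iff M_def matrix_vector_mult_def mult.commute)
  qed
  have inv: "M h ** M k = mat 1"
    if "linear_over S ?V h" "linear_over S ?V k" "\<And>x. x \<in> ?V \<Longrightarrow> k x \<in> ?V" "\<And>x. x \<in> ?V \<Longrightarrow> h (k x) = x" for h k
  proof -
    have "column j (M h ** M k) = column j (mat 1)" for j
    proof -
      have "column j (M h ** M k) = M h *v (M k *v axis j 1)"
        by (simp add: column_def vec_eq_iff matrix_vector_mult_def matrix_matrix_mult_def axis_def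
            if_distrib cong: if_cong)
      also have "\<dots> = axis j 1" using that e by (simp add: Mv)
      also have "\<dots> = column j (mat 1)" by (simp add: column_def mat_def axis_def vec_eq_iff)
      finally show ?thesis .
    qed
    then show ?thesis by (simp add: column_def vec_eq_iff)
  qed
  show "isometric_over S A B"
    unfolding isometric_over_def vec_in_iff_coord_space
    by (intro exI[of _ "M f"] exI[of _ "M g"] conjI MS inv allI impI f) (simp_all add: Mv f)
qed

text \<open>Vanishing on \<open>K\<close>-vectors would not suffice for general polynomials over a
  finite \<open>K\<close>; a quadratic form, however, is determined by its values on the axes and on
  sums of two axes.\<close>

lemma form_zero_extends:
  fixes q :: "'a::field ^ 'n::finite \<Rightarrow> 'a"
  assumes K: "is_subfield K" and q: "form_over UNIV q" and zero: "\<And>x. x \<in> coord_space K UNIV \<Longrightarrow> q x = 0"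
  shows "q x = 0"
proof -
  note fp = form_over_polar[OF q]
  have e: "axis i 1 \<in> coord_space K UNIV" for i :: 'n by (intro coord_space_closed[OF K]) simp
  have "polar q (axis i 1) (axis j 1) = 0" for i j
    using zero e coord_space_closed(2)[OF K e e] by (simp add: polar_def)
  then have p: "polar q (axis i 1) y = 0" for i y
    by (intro polar_vanish[OF q, of UNIV _ y UNIV]) (auto simp: coord_space_def)
  have "q (\<Sum>i\<in>I. x $ i *s axis i 1) = 0" for I
    using finite[of I] by (induction I rule: finite_induct) (simp_all add: fp(1,2,3,11) p zero[OF e])
  then have "q (\<Sum>i\<in>UNIV. x $ i *s axis i 1) = 0" .
  moreover have "x \<in> coord_space UNIV UNIV" by (simp add: coord_space_def)
  ultimately show ?thesis using coord_space_expand by metis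
qed

text \<open>\<open>isometric_over\<close> compares values on \<open>K\<close>-vectors only, so
  extending scalars means showing that the difference of the two forms vanishes identically.\<close>

lemma isometric_over_extend:
  fixes A B :: "'a::field ^ 'n::finite ^ 'n"
  assumes K: "is_subfield K" and "isometric_over K A B"
  shows "isometric_over UNIV A B"
proof -
  obtain T T' where T: "T ** T' = mat 1" "T' ** T = mat 1"
      "\<And>x. x \<in> coord_space K UNIV \<Longrightarrow> qf B (T *v x) = qf A x"
    using assms(2) unfolding isometric_over_def vec_in_iff_coord_space by blast
  have "form_over UNIV (\<lambda>x. qf B (T *v x))"
    by (rule form_over_comp[OF is_subfield_UNIV])
      (auto simp: form_over_def mat_in_def coord_space_def linear_over_def matrix_vector_right_distrib vector_scalar_commute)
  then obtain C where C: "\<And>x. qf B (T *v x) = qf C x" by (auto simp: form_over_def fun_eq_iff)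
  have D: "qf (C - A) x = qf C x - qf A x" for x
    by (simp add: qf_def algebra_simps sum_subtractf)
  have "form_over UNIV (qf (C - A))" by (auto simp: form_over_def mat_in_def)
  then have "qf (C - A) x = 0" for x
    by (rule form_zero_extends[OF K]) (simp add: D T(3) flip: C)
  then have "qf B (T *v x) = qf A x" for x using C D by simp
  then show ?thesis using T(1,2) unfolding isometric_over_def mat_in_def by blast
qed

theorem theorem6p5:
  fixes K :: "'a::field set" and A B :: "'a ^'n::finite ^'n"
  assumes "CHAR('a) = 2"
    and "is_subfield K"
    and "odd_degree_over K"
    and "mat_in K A" and "mat_in K B"
  shows "(similar_over K A B \<longleftrightarrow> similar_over UNIV A B) \<and>
         (\<forall>l p. l \<noteq> 0 \<and> isometric_over UNIV A (qscale l B) \<and> is_min_poly K l p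
            \<longrightarrow> isometric_over K A (qscale (coeff p 0) B))"
proof -
  note K = \<open>is_subfield K\<close>
  obtain N where N: "has_degree K N" "odd N"
    using \<open>odd_degree_over K\<close> has_degree_if_basis_over unfolding odd_degree_over_def by blast
  have forms: "form_over K (qf A)" "form_over K (qf B)"
    using \<open>mat_in K A\<close> \<open>mat_in K B\<close> by (auto simp: form_over_def)
  \<comment> \<open>The descent produces the factor \<open>- coeff p 0\<close>; characteristic 2
    removes the sign.\<close>
  have neg: "- x = x" for x :: 'a
    using uminus_CHAR_2[OF assms(1)] by simp
  have descent: "isometric_over K A (qscale (coeff p 0) B)"
    if "l \<noteq> 0" "isometric_over UNIV A (qscale l B)" "is_min_poly K l p" for l p
  proof -
    have "isometric_on UNIV UNIV UNIV (qf A) (\<lambda>x. l * qf B x)"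
      using that(2) unfolding isometric_over_iff_isometric_on[OF is_subfield_UNIV] qf_qscale .
    from similitude_descent_general[OF K N that(3,1) forms refl this]
    show ?thesis unfolding isometric_over_iff_isometric_on[OF K] qf_qscale neg .
  qed
  have "similar_over K A B \<longleftrightarrow> similar_over UNIV A B"
  proof
    assume "similar_over K A B"
    then show "similar_over UNIV A B"
      using isometric_over_extend[OF K] unfolding similar_over_def by blast
  next
    assume "similar_over UNIV A B"
    then obtain l where l: "l \<noteq> 0" "isometric_over UNIV A (qscale l B)"
      by (auto simp: similar_over_def)
    obtain p where p: "is_min_poly K l p" using min_poly_exists[OF K N(1)] by blast
    show "similar_over K A B"
      unfolding similar_over_def using descent[OF l p] min_poly_const_nonzero[OF K p l(1)] by blast
  qed
  then show ?thesis using descent by blast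
qed

end
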